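(* Let $(X,d_X)$ and $(Y,d_Y)$ be compact metric spaces, let $\mu\in\mathcal{P}(X)$ and $\nu\in\mathcal{P}(Y)$ with $\operatorname{supp}(\mu)=X$ and $\operatorname{supp}(\nu)=Y$, let $c:X\times Y\to\mathbb{R}$ be Lipschitz continuous, and put $A=-c$. Then the function $$\beta\mapsto P(\beta A)-\beta\, m(A),\qquad \beta>0,$$ is non-increasing, and $\lim_{\beta\to+\infty}\left[P(\beta A)-\beta\, m(A)\right]=H_{\max}$. Furthermore, if $\pi_\infty$ is an accumulation point, in the weak* topology, of $\pi_\beta$ as $\beta\to+\infty$, then $\pi_\infty\in\mathcal{M}_{\max}(A)$ and $H(\pi_\infty)=H_{\max}$ (which can be $-\infty$).
   Context: $\mathcal{P}(Z)$ denotes the Borel probabilities on a compact metric space $Z$ and $C(Z)$ the continuous real functions on $Z$. The product $X\times Y$ carries the metric $d_X+d_Y$. $\Pi(\mu,\nu)$ is the set of $\pi\in\mathcal{P}(X\times Y)$ with $x$-marginal $\mu$ and $y$-marginal $\nu$. For probabilities $\eta,\rho$ on the same measurable space, $D_{KL}(\eta|\rho)=\int\log\left(\frac{d\eta}{d\rho}\right)d\eta$ if $\eta\ll\rho$, and $+\infty$ otherwise. For $\pi\in\Pi(\mu,\nu)$, $H(\pi)=-D_{KL}(\pi\,|\,\mu\times\nu)\in[-\infty,0]$. For continuous $B:X\times Y\to\mathbb{R}$, $P(B)=\sup_{\pi\in\Pi(\mu,\nu)}\left[\int B\,d\pi+H(\pi)\right]$. $m(A)=\sup_{\pi\in\Pi(\mu,\nu)}\int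 A\,d\pi$; $\mathcal{M}_{\max}(A)=\{\pi\in\Pi(\mu,\nu):\int A\,d\pi=m(A)\}$; $H_{\max}=\sup_{\pi\in\mathcal{M}_{\max}(A)}H(\pi)\in[-\infty,0]$. For each $\beta>0$ there is a pair $\varphi_\beta\in C(X)$, $\psi_\beta\in C(Y)$, unique up to replacing it by $(\varphi_\beta+d_\beta,\psi_\beta-d_\beta)$ with $d_\beta\in\mathbb{R}$ a constant, such that $\int_X e^{\beta A(x,y)+\varphi_\beta(x)+\psi_\beta(y)}\,d\mu(x)=1$ for all $y\in Y$ and $\int_Y e^{\beta A(x,y)+\varphi_\beta(x)+\psi_\beta(y)}\,d\nu(y)=1$ for all $x\in X$. The probability $\pi_\beta\in\Pi(\mu,\nu)$ is defined by $d\pi_\beta=e^{\beta A+\varphi_\beta+\psi_\beta}\,d\mu\,d\nu$. *)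

theory Defs
  imports "HOL-Probability.Probability"
begin

definition borel_probs :: "'z::topological_space measure set" where
  "borel_probs = {\<eta>. prob_space \<eta> \<and> sets \<eta> = sets borel}"

definition measure_support :: "'z::topological_space measure \<Rightarrow> 'z set" where
  "measure_support \<eta> = {z. \<forall>U. open U \<longrightarrow> z \<in> U \<longrightarrow> emeasure \<eta> U > 0}"

text \<open>The metric on \<open>X \<times> Y\<close> is \<open>d_X + d_Y\<close>, whereas \<^const>\<open>dist\<close> on the product type is the
  (equivalent) Euclidean combination; hence \<^const>\<open>lipschitz_on\<close> is not used here.\<close>

definition sum_dist :: "'x::metric_space \<times> 'y::metric_space \<Rightarrow> 'x \<times> 'y \<Rightarrow> real" where
  "sum_dist p q = dist (fst p) (fst q) + dist (snd p) (snd q)"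

definition lipschitz_sum_dist :: "('x::metric_space \<times> 'y::metric_space \<Rightarrow> real) \<Rightarrow> bool" where
  "lipschitz_sum_dist c \<longleftrightarrow> (\<exists>L. \<forall>p q. \<bar>c p - c q\<bar> \<le> L * sum_dist p q)"

definition couplings ::
  "'x::topological_space measure \<Rightarrow> 'y::topological_space measure \<Rightarrow> ('x \<times> 'y) measure set" where
  "couplings \<mu> \<nu> = {\<pi> \<in> borel_probs. distr \<pi> borel fst = \<mu> \<and> distr \<pi> borel snd = \<nu>}"

text \<open>The library's \<^const>\<open>KL_divergence\<close> is real-valued and is \<open>0\<close> when the log-density is not
  integrable, so the integral is taken here in the extended reals, as positive part minus negative
  part. For probabilities the negative part is finite (\<open>t * ln t \<ge> - 1 / e\<close>), so \<open>\<infinity> - \<infinity>\<close> does not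
  occur. \<open>entropy_density (exp 1) \<rho> \<eta>\<close> is the natural logarithm of \<open>d\<eta>/d\<rho>\<close>.\<close>

definition D_KL :: "'z measure \<Rightarrow> 'z measure \<Rightarrow> ereal" where
  "D_KL \<eta> \<rho> =
     (if absolutely_continuous \<rho> \<eta>
      then enn2ereal (\<integral>\<^sup>+ z. ennreal (entropy_density (exp 1) \<rho> \<eta> z) \<partial>\<eta>)
           - enn2ereal (\<integral>\<^sup>+ z. ennreal (- entropy_density (exp 1) \<rho> \<eta> z) \<partial>\<eta>)
      else \<infinity>)"

definition plan_entropy :: "'x measure \<Rightarrow> 'y measure \<Rightarrow> ('x \<times> 'y) measure \<Rightarrow> ereal" where
  "plan_entropy \<mu> \<nu> \<pi> = - D_KL \<pi> (\<mu> \<Otimes>\<^sub>M \<nu>)"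

definition pressure ::
  "'x::topological_space measure \<Rightarrow> 'y::topological_space measure \<Rightarrow> ('x \<times> 'y \<Rightarrow> real) \<Rightarrow> ereal" where
  "pressure \<mu> \<nu> B = (SUP \<pi>\<in>couplings \<mu> \<nu>. ereal (\<integral>p. B p \<partial>\<pi>) + plan_entropy \<mu> \<nu> \<pi>)"

definition max_integral ::
  "'x::topological_space measure \<Rightarrow> 'y::topological_space measure \<Rightarrow> ('x \<times> 'y \<Rightarrow> real) \<Rightarrow> real" where
  "max_integral \<mu> \<nu> A = (SUP \<pi>\<in>couplings \<mu> \<nu>. \<integral>p. A p \<partial>\<pi>)"

definition maximizing_plans ::
  "'x::topological_space measure \<Rightarrow> 'y::topological_space measure \<Rightarrow> ('x \<times> 'y \<Rightarrow> real)
    \<Rightarrow> ('x \<times> 'y) measure set" where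
  "maximizing_plans \<mu> \<nu> A = {\<pi> \<in> couplings \<mu> \<nu>. (\<integral>p. A p \<partial>\<pi>) = max_integral \<mu> \<nu> A}"

definition H_max ::
  "'x::topological_space measure \<Rightarrow> 'y::topological_space measure \<Rightarrow> ('x \<times> 'y \<Rightarrow> real) \<Rightarrow> ereal" where
  "H_max \<mu> \<nu> A = (SUP \<pi>\<in>maximizing_plans \<mu> \<nu> A. plan_entropy \<mu> \<nu> \<pi>)"

definition normalizing_pair ::
  "'x::topological_space measure \<Rightarrow> 'y::topological_space measure \<Rightarrow> ('x \<times> 'y \<Rightarrow> real)
    \<Rightarrow> ('x \<Rightarrow> real) \<Rightarrow> ('y \<Rightarrow> real) \<Rightarrow> bool" where
  "normalizing_pair \<mu> \<nu> B \<phi> \<psi> \<longleftrightarrow>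
     continuous_on UNIV \<phi> \<and> continuous_on UNIV \<psi> \<and>
     (\<forall>y. (\<integral>x. exp (B (x, y) + \<phi> x + \<psi> y) \<partial>\<mu>) = 1) \<and>
     (\<forall>x. (\<integral>y. exp (B (x, y) + \<phi> x + \<psi> y) \<partial>\<nu>) = 1)"

definition gibbs_plan ::
  "'x measure \<Rightarrow> 'y measure \<Rightarrow> ('x \<times> 'y \<Rightarrow> real) \<Rightarrow> ('x \<Rightarrow> real) \<Rightarrow> ('y \<Rightarrow> real)
    \<Rightarrow> ('x \<times> 'y) measure" where
  "gibbs_plan \<mu> \<nu> B \<phi> \<psi> =
     density (\<mu> \<Otimes>\<^sub>M \<nu>) (\<lambda>(x, y). ennreal (exp (B (x, y) + \<phi> x + \<psi> y)))"

text \<open>The coarsest topology on \<open>borel_probs\<close> for which \<open>\<eta> \<mapsto> \<integral> f d\<eta>\<close> is continuous for every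
  continuous \<open>f\<close>; it is the weak* topology when the underlying space is compact.\<close>

definition weak_star_topology :: "'z::topological_space measure topology" where
  "weak_star_topology = topology_generated_by
     {{\<eta> \<in> borel_probs. (\<integral>z. f z \<partial>\<eta>) \<in> U} | f U.
        continuous_on UNIV (f :: 'z \<Rightarrow> real) \<and> open U}"

definition accumulation_point :: "'b topology \<Rightarrow> ('a \<Rightarrow> 'b) \<Rightarrow> 'a filter \<Rightarrow> 'b \<Rightarrow> bool" where
  "accumulation_point T g F l \<longleftrightarrow>
     l \<in> topspace T \<and> (\<forall>U. openin T U \<longrightarrow> l \<in> U \<longrightarrow> (\<exists>\<^sub>F b in F. g b \<in> U))"

end

theory Submission
  imports Defs
begin

text \<open>Write \<open>\<rho> = \<mu> \<times> \<nu>\<close> and \<open>m\<close> for the maximal integral of \<open>A\<close>. For a coupling with density \<open>f\<close>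
  with respect to \<open>\<rho>\<close>, the free energy
  \<open>J\<^sub>\<beta>(f) = \<beta> * (m - \<integral> A f) + D(f)\<close>, with \<open>D\<close> the relative entropy, is a sum of two nonnegative terms,
  and the function of the theorem is minus its infimum \<open>E(\<beta>)\<close> over the couplings with finite \<open>D\<close>. As
  the first term increases with \<open>\<beta>\<close>, so does \<open>E\<close>, and comparing with maximising plans gives
  \<open>E(\<beta>) \<le> - H_max\<close>. The content of the limit statement is that nothing is lost as \<open>\<beta> \<rightarrow> \<infinity>\<close>:
  if \<open>E\<close> is bounded, with supremum \<open>l\<close>, some maximising plan has relative entropy at most \<open>l\<close>.

  The customary argument combines weak compactness of the set of couplings with semicontinuity of the
  entropy. Here strong convexity replaces compactness
  (\<open>L1_dist_le_free_energy_excess\<close>): two densities that are almost minimal at the same \<open>\<beta>\<close> are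
  close in \<open>L\<^sup>1(\<rho>)\<close>, since their midpoint cannot fall below the minimum. A density almost
  minimal at a large \<open>\<beta>\<close> is also almost minimal at every smaller \<open>\<beta>\<close> where \<open>E\<close> is already close to
  \<open>l\<close>. So almost minimal densities along \<open>\<beta> \<rightarrow> \<infinity>\<close> form a Cauchy sequence in \<open>L\<^sup>1\<close>; the limit has the right
  marginals, its gain is \<open>m\<close>, and Fatou's lemma bounds its relative entropy by \<open>l\<close>
  (\<open>zero_temperature_minimiser\<close>).

  The Gibbs plan at \<open>\<beta>\<close> minimises \<open>J\<^sub>\<beta>\<close> exactly (\<open>gibbs_plan_minimises\<close>), because the logarithm of its
  density is \<open>\<beta> A\<close> plus functions of one variable. That the gains of the Gibbs plans tend to \<open>m\<close>
  even when \<open>E\<close> is unbounded needs \<open>E(\<beta>) = o(\<beta>)\<close>, that is, couplings of finite entropy with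
  gain arbitrarily close to \<open>m\<close>; averaging a coupling over the cells of a fine finite partition
  provides them (\<open>finite_entropy_approximation\<close>). Every weak* accumulation point is therefore a
  maximising plan. If \<open>E\<close> is unbounded, then \<open>H_max = -\<infinity>\<close> and its entropy can only be
  \<open>-\<infinity>\<close>; if \<open>E\<close> is bounded, strong convexity once more shows that the Gibbs densities converge in
  \<open>L\<^sup>1\<close> to the limit density found before, which must then be the accumulation point.\<close>

section \<open>Borel measures on compact metric spaces\<close>

text \<open>The centres of finite covers by balls of radius \<open>1 / (n + 1)\<close>, for all \<open>n\<close>. The countable basis is what
  makes the Borel sets of the product coincide with the product of the Borel sets, so that
  the product measure becomes a Borel measure.\<close>

lemma compact_metric_countable_basis:
  assumes "compact (UNIV :: 'a::metric_space set)"
  obtains B :: "'a::metric_space set set" where "countable B" "topological_basis B"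
proof -
  have "\<forall>n::nat. \<exists>k. finite k \<and> (UNIV :: 'a set) \<subseteq> (\<Union>x\<in>k. ball x (1 / real (Suc n)))"
    using assms unfolding compact_eq_totally_bounded by (metis of_nat_0_less_iff zero_less_Suc zero_less_divide_1_iff)
  then obtain C :: "nat \<Rightarrow> 'a set"
    where fin: "\<And>n. finite (C n)"
      and cover: "\<And>n. UNIV \<subseteq> (\<Union>x\<in>C n. ball x (1 / real (Suc n)))"
    by metis
  define B where "B = (\<Union>n. (\<lambda>x. ball x (1 / real (Suc n))) ` C n)"
  have "countable B"
    unfolding B_def using fin by (intro countable_UN countable_image) (auto intro: countable_finite)
  moreover have "topological_basis B"
  proof (rule topological_basisI)
    fix U assume "U \<in> B"
    then show "open U" unfolding B_def by auto
  next
    fix U :: "'a set" and x assume "open U" "x \<in> U"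
    then obtain e where "e > 0" and e: "ball x e \<subseteq> U" by (auto simp: open_contains_ball)
    obtain n where n: "1 / real (Suc n) < e / 2"
      using nat_approx_posE[of "e / 2"] \<open>e > 0\<close> by auto
    obtain z where z: "z \<in> C n" "x \<in> ball z (1 / real (Suc n))" using cover[of n] by blast
    have "ball z (1 / real (Suc n)) \<subseteq> ball x e"
    proof
      fix y assume "y \<in> ball z (1 / real (Suc n))"
      then have "dist x y < 1 / real (Suc n) + 1 / real (Suc n)"
        using z(2) dist_triangle[of x y z] by (auto simp: dist_commute)
      then show "y \<in> ball x e" using n by auto
    qed
    then show "\<exists>B'\<in>B. x \<in> B' \<and> B' \<subseteq> U" using z e unfolding B_def by blast
  qed
  ultimately show ?thesis by (rule that)
qed

lemma sets_borel_pair_compact: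
  assumes "compact (UNIV :: 'a::metric_space set)" and "compact (UNIV :: 'b::metric_space set)"
  shows "sets (borel \<Otimes>\<^sub>M borel) = sets (borel :: ('a \<times> 'b) measure)"
proof
  show "sets (borel \<Otimes>\<^sub>M borel) \<subseteq> sets (borel :: ('a \<times> 'b) measure)"
    unfolding sets_pair_measure
  proof (rule sets.sigma_sets_subset')
    show "{a \<times> b |a b. a \<in> sets borel \<and> b \<in> sets borel} \<subseteq> sets (borel :: ('a \<times> 'b) measure)"
    proof (safe, goal_cases)
      case (1 _ a b)
      have f: "fst \<in> borel \<rightarrow>\<^sub>M (borel :: 'a measure)" and s: "snd \<in> borel \<rightarrow>\<^sub>M (borel :: 'b measure)"
        by (auto intro!: borel_measurable_continuous_onI continuous_intros)
      have "a \<times> b = (fst -` a \<inter> space borel) \<inter> (snd -` b \<inter> space borel)" by auto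
      then show ?case using sets.Int[OF measurable_sets[OF f 1(1)] measurable_sets[OF s 1(2)]] by simp
    qed
  qed simp
next
  obtain B :: "'a set set" where B: "countable B" "topological_basis B"
    using compact_metric_countable_basis assms(1) by blast
  obtain C :: "'b set set" where C: "countable C" "topological_basis C"
    using compact_metric_countable_basis assms(2) by blast
  let ?D = "(\<lambda>(a, b). a \<times> b) ` (B \<times> C)"
  have "borel = sigma UNIV ?D"
    using B C by (intro borel_eq_countable_basis topological_basis_prod) auto
  moreover have "?D \<subseteq> sets (borel \<Otimes>\<^sub>M borel)"
  proof clarsimp
    fix a b assume "a \<in> B" "b \<in> C"
    then have "open a" "open b" using B C topological_basis_open by blast+
    then show "a \<times> b \<in> sets (borel \<Otimes>\<^sub>M borel)" by auto
  qed
  ultimately show "sets (borel :: ('a \<times> 'b) measure) \<subseteq> sets (borel \<Otimes>\<^sub>M borel)"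
    by (metis sets.sigma_sets_subset sets_measure_of space_borel space_pair_measure
        UNIV_Times_UNIV subset_UNIV sets.space_closed Pow_UNIV)
qed

text \<open>The indicator of a nonempty closed set \<open>C\<close> is the decreasing limit of the continuous functions
  \<open>max 0 (1 - n * infdist x C)\<close>, and closed sets form an intersection-stable generator of the Borel
  sets.\<close>

lemma borel_probs_eqI_continuous:
  fixes M N :: "'a::metric_space measure"
  assumes M: "M \<in> borel_probs" and N: "N \<in> borel_probs"
    and eq: "\<And>f :: 'a \<Rightarrow> real. continuous_on UNIV f \<Longrightarrow> (\<And>x. 0 \<le> f x \<and> f x \<le> 1) \<Longrightarrow>
      (\<integral>x. f x \<partial>M) = (\<integral>x. f x \<partial>N)"
  shows "M = N"
proof -
  interpret M: prob_space M using M by (simp add: borel_probs_def)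
  interpret N: prob_space N using N by (simp add: borel_probs_def)
  have sM[measurable_cong]: "sets M = sets borel" and sN[measurable_cong]: "sets N = sets borel"
    using M N by (auto simp: borel_probs_def)
  have spM: "space M = UNIV" and spN: "space N = UNIV"
    using sets_eq_imp_space_eq[OF sM] sets_eq_imp_space_eq[OF sN] by auto
  have closed: "emeasure M C = emeasure N C" if "closed C" for C
  proof (cases "C = {}")
    case False
    define f where "f n x = max 0 (1 - real n * infdist x C)" for n x
    have cont: "continuous_on UNIV (f n)" for n
      unfolding f_def by (intro continuous_intros)
    have f[measurable]: "f n \<in> borel_measurable borel" for n
      using cont by (rule borel_measurable_continuous_onI)
    have bound: "0 \<le> f n x \<and> f n x \<le> 1" for n x
      unfolding f_def by (simp add: infdist_nonneg)
    have lim: "(\<lambda>n. f n x) \<longlonglongrightarrow> indicator C x" for x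
    proof (cases "x \<in> C")
      case True
      then show ?thesis unfolding f_def by simp
    next
      case nin: False
      then have pos: "infdist x C > 0"
        using that False by (intro infdist_pos_not_in_closed)
      then obtain k where k: "1 < real k * infdist x C" using reals_Archimedean3 by blast
      have "\<forall>\<^sub>F n in sequentially. f n x = 0"
        using eventually_ge_at_top[of k]
      proof eventually_elim
        case (elim n)
        then have "real k * infdist x C \<le> real n * infdist x C"
          using pos by (intro mult_right_mono) auto
        with k show ?case unfolding f_def by simp
      qed
      then show ?thesis using nin by (simp add: tendsto_eventually)
    qed
    have C[measurable]: "C \<in> sets borel" using that by auto
    have "(\<lambda>n. \<integral>x. f n x \<partial>M) \<longlonglongrightarrow> (\<integral>x. indicator C x \<partial>M)"
      by (rule integral_dominated_convergence[where w="\<lambda>_. 1"]) (use lim bound in auto)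
    moreover have "(\<lambda>n. \<integral>x. f n x \<partial>N) \<longlonglongrightarrow> (\<integral>x. indicator C x \<partial>N)"
      by (rule integral_dominated_convergence[where w="\<lambda>_. 1"]) (use lim bound in auto)
    moreover have "(\<integral>x. f n x \<partial>M) = (\<integral>x. f n x \<partial>N)" for n
      using cont bound by (intro eq) auto
    ultimately have "(\<integral>x. indicator C x \<partial>M) = (\<integral>x. indicator C x \<partial>N :: real)"
      by (simp add: LIMSEQ_unique)
    then show ?thesis
      by (simp add: M.emeasure_eq_measure N.emeasure_eq_measure spM spN)
  qed simp
  show ?thesis
  proof (rule measure_eqI_generator_eq[where \<Omega>=UNIV and E="Collect closed" and A="\<lambda>_. UNIV"])
    show "sets M = sigma_sets UNIV (Collect closed)" "sets N = sigma_sets UNIV (Collect closed)"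
      unfolding sM sN by (auto simp: borel_eq_closed)
  qed (use closed M.emeasure_finite in \<open>auto simp: Int_stable_def\<close>)
qed

section \<open>Relative entropy as the integral of a nonnegative convex function\<close>

text \<open>On densities of total mass \<open>1\<close> the affine correction in \<open>t ln t - t + 1\<close> integrates to zero; its
  benefit is that the function is nonnegative, so the positive and negative parts in the definition
  of the divergence merge into a single integral.\<close>

definition kl_fun :: "real \<Rightarrow> real" where
  "kl_fun t = t * ln t - t + 1"

lemma kl_fun_measurable[measurable]: "kl_fun \<in> borel_measurable borel"
  unfolding kl_fun_def by measurable

text \<open>The elementary bound \<open>1 - 1 / s \<le> ln s\<close> at \<open>s = sqrt (a / m)\<close>.\<close>

lemma bregman_ge_sqrt_diff_square:
  fixes a m :: real
  assumes "0 \<le> a" "0 < m"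
  shows "(sqrt a - sqrt m)\<^sup>2 \<le> a * (ln a - ln m) - a + m"
proof (cases "a = 0")
  case True
  then show ?thesis using assms by simp
next
  case False
  then have a: "a > 0" using assms by simp
  define r where "r = sqrt m / sqrt a"
  have "ln r \<le> r - 1"
    unfolding r_def
    using a assms by (intro ln_le_minus_one) auto
  moreover have "ln r = (ln m - ln a) / 2"
    unfolding r_def using a assms by (simp add: ln_div ln_sqrt)
  ultimately have "a * (ln m - ln a) \<le> a * (2 * (r - 1))"
    using a by (intro mult_left_mono) auto
  also have "a * r = sqrt a * sqrt m"
    unfolding r_def using a by (simp add: real_div_sqrt field_simps)
  then have "a * (2 * (r - 1)) = 2 * (sqrt a * sqrt m) - 2 * a"
    by (simp add: algebra_simps)
  finally show ?thesis using a assms by (simp add: power2_diff algebra_simps)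
qed

lemma kl_fun_nonneg: "0 \<le> t \<Longrightarrow> 0 \<le> kl_fun t"
  using bregman_ge_sqrt_diff_square[of t 1] unfolding kl_fun_def
  by (smt (verit) ln_one zero_le_power2)

text \<open>Convex duality: the difference of the two sides is \<open>exp h * kl_fun (b / exp h)\<close>.\<close>

lemma kl_fun_fenchel:
  assumes "0 \<le> b"
  shows "1 - exp h \<le> kl_fun b - h * b"
proof -
  have "0 \<le> (sqrt b - sqrt (exp h))\<^sup>2" by simp
  also have "\<dots> \<le> b * (ln b - ln (exp h)) - b + exp h"
    using assms by (intro bregman_ge_sqrt_diff_square) auto
  finally show ?thesis unfolding kl_fun_def by (simp add: algebra_simps)
qed

lemma kl_fun_bounds:
  assumes "0 \<le> t"
  shows "(sqrt t - 1)\<^sup>2 \<le> kl_fun t" and "kl_fun t \<le> (t - 1)\<^sup>2"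
proof -
  show "(sqrt t - 1)\<^sup>2 \<le> kl_fun t"
    using bregman_ge_sqrt_diff_square[of t 1] assms unfolding kl_fun_def by simp
  show "kl_fun t \<le> (t - 1)\<^sup>2"
  proof (cases "t = 0")
    case False
    then have "t * ln t \<le> t * (t - 1)"
      using assms by (intro mult_left_mono ln_le_minus_one) auto
    then show ?thesis unfolding kl_fun_def by (simp add: power2_eq_square algebra_simps)
  qed (simp add: kl_fun_def)
qed

text \<open>At \<open>0\<close>, where \<open>ln\<close> carries no information, continuity comes from squeezing between the two
  squares above, which both equal \<open>1\<close> there.\<close>

lemma kl_fun_tendsto:
  assumes "x \<longlonglongrightarrow> a" and "\<And>n. 0 \<le> x n"
  shows "(\<lambda>n. kl_fun (x n)) \<longlonglongrightarrow> kl_fun a"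
proof (cases "a = 0")
  case True
  show ?thesis
  proof (rule tendsto_sandwich)
    have "(\<lambda>n. (sqrt (x n) - 1)\<^sup>2) \<longlonglongrightarrow> (sqrt a - 1)\<^sup>2" "(\<lambda>n. (x n - 1)\<^sup>2) \<longlonglongrightarrow> (a - 1)\<^sup>2"
      using assms(1) by (intro tendsto_intros; assumption)+
    then show "(\<lambda>n. (sqrt (x n) - 1)\<^sup>2) \<longlonglongrightarrow> kl_fun a" "(\<lambda>n. (x n - 1)\<^sup>2) \<longlonglongrightarrow> kl_fun a"
      by (simp_all add: True kl_fun_def)
  qed (auto intro!: always_eventually kl_fun_bounds assms(2))
next
  case False
  then show ?thesis using assms(1) unfolding kl_fun_def by (intro tendsto_intros) auto
qed

lemma kl_fun_midpoint_gap:
  fixes a b :: real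
  assumes "0 \<le> a" "0 \<le> b"
  shows "(sqrt a - sqrt ((a + b) / 2))\<^sup>2 \<le> kl_fun a + kl_fun b - 2 * kl_fun ((a + b) / 2)"
proof (cases "a + b = 0")
  case True
  then have "a = 0" "b = 0" using assms by auto
  then show ?thesis by simp
next
  case False
  define m where "m = (a + b) / 2"
  have m: "m > 0" using False assms by (simp add: m_def)
  have "(sqrt a - sqrt m)\<^sup>2 \<le> a * (ln a - ln m) - a + m"
    using bregman_ge_sqrt_diff_square assms m by blast
  moreover have "0 \<le> b * (ln b - ln m) - b + m"
    using bregman_ge_sqrt_diff_square[of b m] assms m by (smt (verit) zero_le_power2)
  moreover have "kl_fun a + kl_fun b - 2 * kl_fun m =
      (a * (ln a - ln m) - a + m) + (b * (ln b - ln m) - b + m)"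
    unfolding kl_fun_def by (simp add: m_def field_simps)
  ultimately show ?thesis unfolding m_def[symmetric] by simp
qed

text \<open>Strong convexity in the form needed for \<open>L\<^sup>1\<close> estimates. With \<open>m\<close> the midpoint,
  \<open>\<bar>a - b\<bar> = 2 * \<bar>sqrt a - sqrt m\<bar> * (sqrt a + sqrt m)\<close>; the inequality between arithmetic and
  geometric mean with weight \<open>s\<close> separates the factors, and the convexity gap controls the square
  of the first one. The free weight \<open>s\<close> replaces an appeal to Cauchy-Schwarz after integration.\<close>

lemma abs_diff_le_kl_fun_gap:
  fixes a b s :: real
  assumes "0 \<le> a" "0 \<le> b" "0 < s"
  shows "\<bar>a - b\<bar> \<le> (kl_fun a + kl_fun b - 2 * kl_fun ((a + b) / 2)) / s + s * (3 * a + b)"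
proof -
  define m where "m = (a + b) / 2"
  have m: "m \<ge> 0" using assms by (simp add: m_def)
  define p q where "p = sqrt a - sqrt m" and "q = sqrt a + sqrt m"
  have gap: "p\<^sup>2 \<le> kl_fun a + kl_fun b - 2 * kl_fun m"
    using kl_fun_midpoint_gap assms unfolding p_def m_def by blast
  have "p * q = a - m" unfolding p_def q_def using assms m by (simp add: algebra_simps)
  then have "\<bar>a - b\<bar> = 2 * \<bar>p * q\<bar>" by (simp add: m_def abs_if field_simps)
  also have "\<dots> \<le> p\<^sup>2 / s + s * q\<^sup>2"
  proof -
    have "0 \<le> (\<bar>p\<bar> / sqrt s - sqrt s * \<bar>q\<bar>)\<^sup>2" by simp
    also have "\<dots> = p\<^sup>2 / s + s * q\<^sup>2 - 2 * (\<bar>p\<bar> * \<bar>q\<bar>)"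
      using assms by (simp add: power2_diff power_divide power_mult_distrib)
    finally show ?thesis by (simp add: abs_mult)
  qed
  also have "p\<^sup>2 / s \<le> (kl_fun a + kl_fun b - 2 * kl_fun m) / s"
    using gap assms by (intro divide_right_mono) auto
  also have "q\<^sup>2 \<le> 2 * (a + m)"
    unfolding q_def using sum_squares_bound[of "sqrt a" "sqrt m"] assms m by (simp add: power2_sum)
  then have "s * q\<^sup>2 \<le> s * (3 * a + b)"
    using assms by (intro mult_left_mono) (auto simp: m_def add_divide_distrib)
  finally show ?thesis by (simp add: m_def)
qed

text \<open>With \<open>P\<close> and \<open>N\<close> the integrals of the positive and the negative part of \<open>f ln f\<close> and \<open>K\<close> the integral of
  \<open>kl_fun f\<close>, integrating \<open>kl_fun f + (f ln f)\<^sup>- + f = (f ln f)\<^sup>+ + 1\<close> gives \<open>P = K + N\<close>. The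
  subtraction \<open>P - N = K\<close> is legitimate because \<open>(f ln f)\<^sup>- \<le> 1\<close>.\<close>

lemma D_KL_density:
  fixes f :: "'z \<Rightarrow> real"
  assumes M: "prob_space M" and f[measurable]: "f \<in> borel_measurable M" and nn: "\<And>z. 0 \<le> f z"
    and one: "(\<integral>\<^sup>+z. ennreal (f z) \<partial>M) = 1"
  shows "D_KL (density M (\<lambda>z. ennreal (f z))) M = enn2ereal (\<integral>\<^sup>+z. ennreal (kl_fun (f z)) \<partial>M)"
proof -
  interpret prob_space M by fact
  let ?N = "density M (\<lambda>z. ennreal (f z))"
  have ac: "absolutely_continuous M ?N" by (rule absolutely_continuousI_density) simp
  have rn: "AE z in M. RN_deriv M ?N z = ennreal (f z)"
    using RN_deriv_unique[of "\<lambda>z. ennreal (f z)" ?N] by auto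
  define P N K where "P = (\<integral>\<^sup>+z. ennreal (f z * ln (f z)) \<partial>M)"
    and "N = (\<integral>\<^sup>+z. ennreal (- (f z * ln (f z))) \<partial>M)"
    and "K = (\<integral>\<^sup>+z. ennreal (kl_fun (f z)) \<partial>M)"
  have "(\<integral>\<^sup>+ z. ennreal (entropy_density (exp 1) M ?N z) \<partial>?N) = P"
    unfolding P_def by (subst nn_integral_density)
      (use rn nn in \<open>auto intro!: nn_integral_cong_AE simp: entropy_density_def log_def simp flip: ennreal_mult'\<close>)
  moreover have "(\<integral>\<^sup>+ z. ennreal (- entropy_density (exp 1) M ?N z) \<partial>?N) = N"
    unfolding N_def by (subst nn_integral_density)
      (use rn nn in \<open>auto intro!: nn_integral_cong_AE simp: entropy_density_def log_def simp flip: ennreal_mult'\<close>)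
  moreover have "K + N + 1 = P + 1"
  proof -
    have "K + N + 1 = (\<integral>\<^sup>+z. ennreal (kl_fun (f z)) + ennreal (- (f z * ln (f z))) + ennreal (f z) \<partial>M)"
      unfolding K_def N_def one[symmetric] by (simp add: nn_integral_add)
    also have "\<dots> = (\<integral>\<^sup>+z. ennreal (f z * ln (f z)) + 1 \<partial>M)"
    proof (rule nn_integral_cong)
      fix z
      show "ennreal (kl_fun (f z)) + ennreal (- (f z * ln (f z))) + ennreal (f z) = ennreal (f z * ln (f z)) + 1"
      proof (cases "f z * ln (f z) \<ge> 0")
        case True
        then show ?thesis using nn[of z] kl_fun_nonneg[of "f z"]
          by (simp add: ennreal_neg kl_fun_def flip: ennreal_plus ennreal_1)
      next
        case False
        then show ?thesis using nn[of z] kl_fun_nonneg[of "f z"]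
          by (simp add: ennreal_neg kl_fun_def flip: ennreal_plus ennreal_1)
      qed
    qed
    also have "\<dots> = P + 1" unfolding P_def by (simp add: nn_integral_add emeasure_space_1)
    finally show ?thesis .
  qed
  then have KN: "P = K + N" by (simp add: ennreal_add_left_cancel add.commute)
  have "N \<le> (\<integral>\<^sup>+z. 1 \<partial>M)"
    unfolding N_def
  proof (rule nn_integral_mono)
    fix z
    have "- (f z * ln (f z)) \<le> 1"
      using kl_fun_nonneg[of "f z"] nn[of z] unfolding kl_fun_def by linarith
    then show "ennreal (- (f z * ln (f z))) \<le> 1" by (simp add: ennreal_le_1)
  qed
  then have "N < \<infinity>" by (simp add: emeasure_space_1 order_le_less_trans)
  then have "enn2ereal P - enn2ereal N = enn2ereal K"
    unfolding KN by (cases N; cases K) (auto simp: enn2ereal_ennreal plus_ennreal.rep_eq)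
  ultimately show ?thesis using ac unfolding D_KL_def K_def by simp
qed


text \<open>The argument behind completeness of \<open>L\<^sup>1\<close>: the increments are summable almost everywhere, and
  \<open>\<bar>f 0\<bar>\<close> plus the sum of their absolute values dominates the whole sequence. The dominating
  function is recorded because it allows passing to the limit in integrals.\<close>

lemma summable_L1_increments_converge:
  fixes f :: "nat \<Rightarrow> 'a \<Rightarrow> real"
  assumes int: "\<And>n. integrable M (f n)"
    and le: "\<And>n. (\<integral>x. \<bar>f (Suc n) x - f n x\<bar> \<partial>M) \<le> c n" and c: "summable c"
  obtains w where "integrable M w" "AE x in M. \<forall>n. \<bar>f n x\<bar> \<le> w x"
    "AE x in M. convergent (\<lambda>n. f n x)"
proof -
  have [measurable]: "f n \<in> borel_measurable M" for n using int by auto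
  define d where "d n x = \<bar>f (Suc n) x - f n x\<bar>" for n x
  have d: "integrable M (d n)" for n unfolding d_def using int by auto
  have dnn: "0 \<le> d n x" for n x by (simp add: d_def)
  have [measurable]: "d n \<in> borel_measurable M" for n using d by auto
  have sumd: "summable (\<lambda>n. \<integral>x. d n x \<partial>M)"
    by (rule summable_comparison_test'[OF c, of 0]) (use le in \<open>auto simp: d_def\<close>)
  have "(\<integral>\<^sup>+x. (\<Sum>n. ennreal (d n x)) \<partial>M) = (\<Sum>n. \<integral>\<^sup>+x. ennreal (d n x) \<partial>M)"
    by (rule nn_integral_suminf) simp
  also have "\<dots> = (\<Sum>n. ennreal (\<integral>x. d n x \<partial>M))"
    using d dnn by (simp add: nn_integral_eq_integral)
  also have "\<dots> < \<infinity>"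
    using sumd dnn by (simp add: suminf_ennreal2 integral_nonneg_AE)
  finally have "AE x in M. (\<Sum>n. ennreal (d n x)) \<noteq> \<infinity>"
    by (intro nn_integral_PInf_AE) auto
  then have summ: "AE x in M. summable (\<lambda>n. d n x)"
    by eventually_elim (rule summable_suminf_not_top, use dnn in simp_all)
  let ?w = "\<lambda>x. \<bar>f 0 x\<bar> + (\<Sum>n. d n x)"
  have "integrable M (\<lambda>x. \<Sum>n. d n x)"
    by (rule integrable_suminf) (use d summ sumd dnn in simp_all)
  then have "integrable M ?w" by (intro Bochner_Integration.integrable_add integrable_abs int)
  moreover have "AE x in M. \<forall>n. \<bar>f n x\<bar> \<le> ?w x"
    using summ
  proof eventually_elim
    case (elim x)
    show ?case
    proof
      fix n
      have "\<bar>f n x\<bar> \<le> \<bar>f 0 x\<bar> + (\<Sum>i<n. d i x)"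
      proof (induction n)
        case (Suc n)
        then show ?case by (simp add: d_def)
      qed simp
      also have "(\<Sum>i<n. d i x) \<le> (\<Sum>i. d i x)"
        using elim dnn by (intro sum_le_suminf) auto
      finally show "\<bar>f n x\<bar> \<le> ?w x" by simp
    qed
  qed
  moreover have "AE x in M. convergent (\<lambda>n. f n x)"
    using summ
  proof eventually_elim
    case (elim x)
    have "summable (\<lambda>n. f (Suc n) x - f n x)"
      by (rule summable_rabs_cancel[OF elim[unfolded d_def]])
    moreover have "(\<Sum>i<n. f (Suc i) x - f i x) = f n x - f 0 x" for n
      by (rule sum_lessThan_telescope[of "\<lambda>n. f n x"])
    ultimately have "convergent (\<lambda>n. f n x - f 0 x)"
      by (simp only: summable_iff_convergent)
    then have "convergent (\<lambda>n. (f n x - f 0 x) + f 0 x)"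
      by (rule convergent_add[OF _ convergent_const])
    then show ?case by simp
  qed
  ultimately show ?thesis by (rule that)
qed

lemma compact_UNIV_continuous_bounded:
  fixes u :: "'a::topological_space \<Rightarrow> real"
  assumes "compact (UNIV :: 'a set)" "continuous_on UNIV u"
  obtains C where "C \<ge> 0" "\<And>z. \<bar>u z\<bar> \<le> C"
proof -
  have "bounded (range u)" using assms by (simp add: compact_continuous_image compact_imp_bounded)
  then obtain C where "\<And>z. \<bar>u z\<bar> \<le> C" unfolding bounded_iff by auto
  then show ?thesis using that[of C] abs_ge_zero[of "u undefined"] by (meson order_trans)
qed

section \<open>Coupling densities and the free energy\<close>

locale transport_problem =
  fixes \<mu> :: "'x::metric_space measure" and \<nu> :: "'y::metric_space measure"
    and A :: "'x \<times> 'y \<Rightarrow> real"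
  assumes compact_X: "compact (UNIV :: 'x set)" and compact_Y: "compact (UNIV :: 'y set)"
    and borel_prob_\<mu>: "\<mu> \<in> borel_probs" and borel_prob_\<nu>: "\<nu> \<in> borel_probs"
    and continuous_A: "continuous_on UNIV A"

sublocale transport_problem \<subseteq> pair_prob_space \<mu> \<nu>
proof -
  interpret \<mu>: prob_space \<mu> using borel_prob_\<mu> by (simp add: borel_probs_def)
  interpret \<nu>: prob_space \<nu> using borel_prob_\<nu> by (simp add: borel_probs_def)
  show "pair_prob_space \<mu> \<nu>" ..
qed

context transport_problem
begin

abbreviation \<rho> :: "('x \<times> 'y) measure" where "\<rho> \<equiv> \<mu> \<Otimes>\<^sub>M \<nu>"

lemma sets_\<mu>[measurable_cong]: "sets \<mu> = sets borel" and sets_\<nu>[measurable_cong]: "sets \<nu> = sets borel"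
  using borel_prob_\<mu> borel_prob_\<nu> by (auto simp: borel_probs_def)

lemma space_\<mu>[simp]: "space \<mu> = UNIV" and space_\<nu>[simp]: "space \<nu> = UNIV"
  using sets_eq_imp_space_eq[OF sets_\<mu>] sets_eq_imp_space_eq[OF sets_\<nu>] by auto

lemma sets_\<rho>[measurable_cong]: "sets \<rho> = sets borel"
proof -
  have "sets \<rho> = sets (borel \<Otimes>\<^sub>M borel)" by (intro sets_pair_measure_cong sets_\<mu> sets_\<nu>)
  then show ?thesis using sets_borel_pair_compact[OF compact_X compact_Y] by simp
qed

lemma space_\<rho>[simp]: "space \<rho> = UNIV"
  by (simp add: space_pair_measure)

lemma compact_XY: "compact (UNIV :: ('x \<times> 'y) set)"
  using compact_Times[OF compact_X compact_Y] by simp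

lemma measurable_fst_borel[measurable]: "fst \<in> borel_measurable (borel :: ('x \<times> 'y) measure)"
  and measurable_snd_borel[measurable]: "snd \<in> borel_measurable (borel :: ('x \<times> 'y) measure)"
  by (auto intro!: borel_measurable_continuous_onI continuous_intros)

lemma strip_measurable[measurable]:
  "B \<in> sets borel \<Longrightarrow> (B \<times> UNIV :: ('x \<times> 'y) set) \<in> sets borel"
  "C \<in> sets borel \<Longrightarrow> (UNIV \<times> C :: ('x \<times> 'y) set) \<in> sets borel"
  by (auto simp flip: sets_\<rho> intro!: pair_measureI simp: sets_\<mu> sets_\<nu>)

lemma A_measurable[measurable]: "A \<in> borel_measurable borel"
  using continuous_A by (rule borel_measurable_continuous_onI)

lemma couplings_prob: "\<pi> \<in> couplings \<mu> \<nu> \<Longrightarrow> prob_space \<pi>"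
  and couplings_sets: "\<pi> \<in> couplings \<mu> \<nu> \<Longrightarrow> sets \<pi> = sets borel"
  and couplings_space: "\<pi> \<in> couplings \<mu> \<nu> \<Longrightarrow> space \<pi> = UNIV"
  by (auto simp: couplings_def borel_probs_def dest: sets_eq_imp_space_eq)

lemma integrable_continuous:
  fixes u :: "'a::topological_space \<Rightarrow> real"
  assumes "compact (UNIV :: 'a set)" "continuous_on UNIV u" "M \<in> borel_probs"
  shows "integrable M u"
proof -
  interpret prob_space M using assms(3) by (simp add: borel_probs_def)
  have [measurable_cong]: "sets M = sets borel" using assms(3) by (simp add: borel_probs_def)
  have [measurable]: "u \<in> borel_measurable borel" using assms(2) by (rule borel_measurable_continuous_onI)
  obtain C where "\<And>z. \<bar>u z\<bar> \<le> C" using compact_UNIV_continuous_bounded assms by blast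
  then show ?thesis by (intro integrable_const_bound[where B=C]) auto
qed

text \<open>The marginal conditions are stated as linear equations in the density, so that they pass to
  midpoints and to \<open>L\<^sup>1\<close>-limits at once.\<close>

definition coupling_density :: "('x \<times> 'y \<Rightarrow> real) \<Rightarrow> bool" where
  "coupling_density f \<longleftrightarrow> f \<in> borel_measurable borel \<and> (\<forall>z. 0 \<le> f z) \<and> integrable \<rho> f
    \<and> (\<forall>B\<in>sets borel. (\<integral>z. indicator (B \<times> UNIV) z * f z \<partial>\<rho>) = measure \<mu> B)
    \<and> (\<forall>C\<in>sets borel. (\<integral>z. indicator (UNIV \<times> C) z * f z \<partial>\<rho>) = measure \<nu> C)"

abbreviation plan :: "('x \<times> 'y \<Rightarrow> real) \<Rightarrow> ('x \<times> 'y) measure" where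
  "plan f \<equiv> density \<rho> (\<lambda>z. ennreal (f z))"

lemma coupling_densityD:
  assumes "coupling_density f"
  shows coupling_density_measurable: "f \<in> borel_measurable borel"
    and coupling_density_nonneg: "0 \<le> f z"
    and coupling_density_integrable: "integrable \<rho> f"
  using assms unfolding coupling_density_def by blast+

lemma coupling_density_integral:
  assumes "coupling_density f"
  shows "(\<integral>z. f z \<partial>\<rho>) = 1"
proof -
  have "(\<integral>z. indicator (UNIV \<times> UNIV) z * f z \<partial>\<rho>) = measure \<mu> UNIV"
    using assms by (simp add: coupling_density_def del: UNIV_Times_UNIV)
  then show ?thesis using M1.prob_space by simp
qed

lemma coupling_density_nn_integral:
  assumes "coupling_density f"
  shows "(\<integral>\<^sup>+z. ennreal (f z) \<partial>\<rho>) = 1"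
  using coupling_densityD[OF assms] coupling_density_integral[OF assms]
  by (subst nn_integral_eq_integral) auto

lemma emeasure_plan:
  assumes [measurable]: "f \<in> borel_measurable borel" "S \<in> sets borel"
    and "\<And>z. 0 \<le> f z" "integrable \<rho> f"
  shows "emeasure (plan f) S = ennreal (\<integral>z. indicator S z * f z \<partial>\<rho>)"
proof -
  have "emeasure (plan f) S = (\<integral>\<^sup>+z. ennreal (indicator S z * f z) \<partial>\<rho>)"
    by (subst emeasure_density) (auto intro!: nn_integral_cong split: split_indicator)
  also have "\<dots> = ennreal (\<integral>z. indicator S z * f z \<partial>\<rho>)"
    using assms by (intro nn_integral_eq_integral integrable_mult_indicator[of S \<rho> f, simplified]) (auto simp: sets_\<rho>)
  finally show ?thesis .
qed

lemma plan_mem_couplings: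
  assumes "coupling_density f"
  shows "plan f \<in> couplings \<mu> \<nu>"
proof -
  note f = coupling_densityD[OF assms]
  note [measurable] = f(1)
  have e: "emeasure (plan f) S = ennreal (\<integral>z. indicator S z * f z \<partial>\<rho>)" if "S \<in> sets borel" for S
    using that f by (intro emeasure_plan) auto
  have "prob_space (plan f)"
    by (rule prob_spaceI) (simp add: e coupling_density_integral[OF assms])
  moreover have "distr (plan f) borel fst = \<mu>"
  proof (rule measure_eqI)
    fix B assume "B \<in> sets (distr (plan f) borel fst)"
    then have [measurable]: "B \<in> sets borel" by simp
    have "emeasure (distr (plan f) borel fst) B = emeasure (plan f) (B \<times> UNIV)"
      by (subst emeasure_distr) (auto intro!: arg_cong[where f="emeasure _"])
    then show "emeasure (distr (plan f) borel fst) B = emeasure \<mu> B"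
      using assms by (simp add: e coupling_density_def M1.emeasure_eq_measure)
  qed (simp add: sets_\<mu>)
  moreover have "distr (plan f) borel snd = \<nu>"
  proof (rule measure_eqI)
    fix B assume "B \<in> sets (distr (plan f) borel snd)"
    then have [measurable]: "B \<in> sets borel" by simp
    have "emeasure (distr (plan f) borel snd) B = emeasure (plan f) (UNIV \<times> B)"
      by (subst emeasure_distr) (auto intro!: arg_cong[where f="emeasure _"])
    then show "emeasure (distr (plan f) borel snd) B = emeasure \<nu> B"
      using assms by (simp add: e coupling_density_def M2.emeasure_eq_measure)
  qed (simp add: sets_\<nu>)
  ultimately show ?thesis by (simp add: couplings_def borel_probs_def sets_\<rho>)
qed

lemma couplings_emeasure:
  assumes \<pi>: "\<pi> \<in> couplings \<mu> \<nu>"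
  shows "B \<in> sets borel \<Longrightarrow> emeasure \<pi> (B \<times> UNIV) = emeasure \<mu> B"
    and "C \<in> sets borel \<Longrightarrow> emeasure \<pi> (UNIV \<times> C) = emeasure \<nu> C"
proof -
  have [measurable_cong]: "sets \<pi> = sets borel" and sp: "space \<pi> = UNIV"
    using \<pi> couplings_sets couplings_space by auto
  have d: "distr \<pi> borel fst = \<mu>" "distr \<pi> borel snd = \<nu>" using \<pi> by (auto simp: couplings_def)
  show "emeasure \<pi> (B \<times> UNIV) = emeasure \<mu> B" if [measurable]: "B \<in> sets borel"
    unfolding d(1)[symmetric] by (subst emeasure_distr) (auto simp: sp intro!: arg_cong[where f="emeasure _"])
  show "emeasure \<pi> (UNIV \<times> C) = emeasure \<nu> C" if [measurable]: "C \<in> sets borel"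
    unfolding d(2)[symmetric] by (subst emeasure_distr) (auto simp: sp intro!: arg_cong[where f="emeasure _"])
qed

lemma coupling_densityI_plan:
  assumes f[measurable]: "f \<in> borel_measurable borel" and nn: "\<And>z. 0 \<le> f z"
    and \<pi>: "plan f \<in> couplings \<mu> \<nu>"
  shows "coupling_density f"
proof -
  interpret \<pi>: prob_space "plan f" using \<pi> by (rule couplings_prob)
  have "(\<integral>\<^sup>+z. ennreal (f z) \<partial>\<rho>) = 1"
    using \<pi>.emeasure_space_1 by (subst (asm) emeasure_density) auto
  then have int: "integrable \<rho> f" using nn by (intro integrableI_bounded) auto
  have *: "(\<integral>z. indicator S z * f z \<partial>\<rho>) = measure (plan f) S" if "S \<in> sets borel" for S
    using emeasure_plan[OF f that nn int] nn by (simp add: measure_def integral_nonneg_AE)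
  show ?thesis
    unfolding coupling_density_def
    using nn int couplings_emeasure[OF \<pi>] by (auto simp: * measure_def)
qed

lemma integral_plan:
  fixes u :: "'x \<times> 'y \<Rightarrow> real"
  assumes "coupling_density f" "u \<in> borel_measurable borel"
  shows "(\<integral>z. u z \<partial>plan f) = (\<integral>z. u z * f z \<partial>\<rho>)"
  using coupling_densityD[OF assms(1)] assms(2)
  by (subst integral_real_density) (auto simp: mult.commute)

lemma integrable_bounded_mult:
  fixes u f :: "'x \<times> 'y \<Rightarrow> real"
  assumes "integrable \<rho> f" "u \<in> borel_measurable borel" "\<And>z. \<bar>u z\<bar> \<le> C"
  shows "integrable \<rho> (\<lambda>z. u z * f z)"
proof (rule Bochner_Integration.integrable_bound)
  show "integrable \<rho> (\<lambda>z. C * f z)" using assms(1) by simp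
  show "(\<lambda>z. u z * f z) \<in> borel_measurable \<rho>" using assms(1,2) by (auto simp: measurable_cong_sets[OF sets_\<rho> refl])
  show "AE z in \<rho>. norm (u z * f z) \<le> norm (C * f z)"
    using assms(3) by (auto simp: abs_mult intro!: mult_right_mono order_trans[OF assms(3) abs_ge_self])
qed

lemma A_bounded: obtains C where "C \<ge> 0" "\<And>z. \<bar>A z\<bar> \<le> C"
  using compact_UNIV_continuous_bounded[OF compact_XY continuous_A] by blast

definition cost_gain :: "('x \<times> 'y \<Rightarrow> real) \<Rightarrow> real" where
  "cost_gain f = (\<integral>z. A z * f z \<partial>\<rho>)"

definition divergence :: "('x \<times> 'y \<Rightarrow> real) \<Rightarrow> real" where
  "divergence f = (\<integral>z. kl_fun (f z) \<partial>\<rho>)"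

definition finite_entropy_densities :: "('x \<times> 'y \<Rightarrow> real) set" where
  "finite_entropy_densities = {f. coupling_density f \<and> integrable \<rho> (\<lambda>z. kl_fun (f z))}"

abbreviation "m \<equiv> max_integral \<mu> \<nu> A"

text \<open>The negative of the quantity maximised by the pressure, normalised so that both summands are
  nonnegative.\<close>

definition free_energy :: "real \<Rightarrow> ('x \<times> 'y \<Rightarrow> real) \<Rightarrow> real" where
  "free_energy \<beta> f = \<beta> * (m - cost_gain f) + divergence f"

definition min_free_energy :: "real \<Rightarrow> real" where
  "min_free_energy \<beta> = (INF f\<in>finite_entropy_densities. free_energy \<beta> f)"

lemma finite_entropyD:
  assumes "f \<in> finite_entropy_densities"
  shows "coupling_density f" "integrable \<rho> (\<lambda>z. kl_fun (f z))"
  using assms by (auto simp: finite_entropy_densities_def)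

lemma one_mem_finite_entropy: "(\<lambda>_. 1) \<in> finite_entropy_densities"
proof -
  have "measure \<rho> (B \<times> UNIV) = measure \<mu> B" if "B \<in> sets borel" for B
    using that M2.emeasure_space_1 by (simp add: measure_def M2.emeasure_pair_measure_Times sets_\<mu> sets_\<nu>)
  moreover have "measure \<rho> (UNIV \<times> C) = measure \<nu> C" if "C \<in> sets borel" for C
    using that M1.emeasure_space_1 by (simp add: measure_def M2.emeasure_pair_measure_Times sets_\<mu> sets_\<nu>)
  ultimately show ?thesis
    by (auto simp: finite_entropy_densities_def coupling_density_def)
qed

lemma divergence_nonneg: "coupling_density f \<Longrightarrow> 0 \<le> divergence f"
  unfolding divergence_def by (intro integral_nonneg_AE) (auto intro: kl_fun_nonneg coupling_density_nonneg)

lemma integral_A_le_max: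
  assumes "\<pi> \<in> couplings \<mu> \<nu>"
  shows "(\<integral>z. A z \<partial>\<pi>) \<le> m"
proof -
  obtain C where C: "\<And>z. \<bar>A z\<bar> \<le> C" using A_bounded by blast
  have "(\<integral>z. A z \<partial>\<pi>) \<le> C" if \<pi>: "\<pi> \<in> couplings \<mu> \<nu>" for \<pi>
  proof -
    interpret prob_space \<pi> using \<pi> by (rule couplings_prob)
    have "integrable \<pi> A"
      using \<pi> compact_XY continuous_A by (intro integrable_continuous) (auto simp: couplings_def)
    then show ?thesis by (intro integral_le_const AE_I2 order_trans[OF abs_ge_self C])
  qed
  then show ?thesis unfolding max_integral_def
    by (intro cSUP_upper assms bdd_aboveI2[where M=C])
qed

lemma cost_gain_eq: "coupling_density f \<Longrightarrow> (\<integral>z. A z \<partial>plan f) = cost_gain f"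
  unfolding cost_gain_def by (intro integral_plan) auto

lemma cost_gain_le_max: "coupling_density f \<Longrightarrow> cost_gain f \<le> m"
  using integral_A_le_max[OF plan_mem_couplings] cost_gain_eq by metis

lemma D_KL_plan:
  assumes "coupling_density f"
  shows "D_KL (plan f) \<rho> = enn2ereal (\<integral>\<^sup>+z. ennreal (kl_fun (f z)) \<partial>\<rho>)"
  using coupling_densityD[OF assms] coupling_density_nn_integral[OF assms]
  by (intro D_KL_density) (auto intro: P.prob_space_axioms simp: measurable_cong_sets[OF sets_\<rho> refl])

lemma plan_entropy_plan:
  assumes "f \<in> finite_entropy_densities"
  shows "plan_entropy \<mu> \<nu> (plan f) = ereal (- divergence f)"
proof -
  note f = finite_entropyD[OF assms]
  have "(\<integral>\<^sup>+z. ennreal (kl_fun (f z)) \<partial>\<rho>) = ennreal (divergence f)"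
    unfolding divergence_def using f
    by (intro nn_integral_eq_integral) (auto intro: kl_fun_nonneg coupling_density_nonneg)
  then show ?thesis
    using f divergence_nonneg by (simp add: plan_entropy_def D_KL_plan enn2ereal_ennreal)
qed

text \<open>A plan of finite entropy is absolutely continuous, and a real-valued version of its
  Radon-Nikodym derivative is a coupling density; so real integrals of densities suffice from here
  on.\<close>

lemma plan_entropy_finite_cases:
  assumes \<pi>: "\<pi> \<in> couplings \<mu> \<nu>" and fin: "plan_entropy \<mu> \<nu> \<pi> \<noteq> -\<infinity>"
  obtains f where "f \<in> finite_entropy_densities" "\<pi> = plan f"
proof -
  interpret \<pi>: prob_space \<pi> using \<pi> by (rule couplings_prob)
  have sets: "sets \<pi> = sets \<rho>" using couplings_sets[OF \<pi>] by (simp add: sets_\<rho>)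
  have ac: "absolutely_continuous \<rho> \<pi>"
    using fin unfolding plan_entropy_def D_KL_def by (auto split: if_splits)
  define f where "f z = enn2real (RN_deriv \<rho> \<pi> z)" for z
  have [measurable]: "RN_deriv \<rho> \<pi> \<in> borel_measurable borel"
    using borel_measurable_RN_deriv[of \<rho> \<pi>] by (simp add: measurable_cong_sets[OF sets_\<rho> refl])
  have f[measurable]: "f \<in> borel_measurable borel" unfolding f_def by measurable
  have "AE z in \<rho>. RN_deriv \<rho> \<pi> z \<noteq> \<infinity>"
    by (rule P.RN_deriv_finite) (use ac sets \<pi>.sigma_finite_measure_axioms in auto)
  then have "AE z in \<rho>. RN_deriv \<rho> \<pi> z = ennreal (f z)"
    by eventually_elim (auto simp: f_def top.not_eq_extremum)
  then have "density \<rho> (RN_deriv \<rho> \<pi>) = plan f" by (intro density_cong) auto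
  then have eq: "\<pi> = plan f" using P.density_RN_deriv[OF ac sets] by simp
  have cd: "coupling_density f" using \<pi> unfolding eq by (intro coupling_densityI_plan) (auto simp: f_def)
  have "(\<integral>\<^sup>+z. ennreal (kl_fun (f z)) \<partial>\<rho>) \<noteq> \<infinity>"
    using fin unfolding eq plan_entropy_def D_KL_plan[OF cd] by auto
  then have "integrable \<rho> (\<lambda>z. kl_fun (f z))"
    by (intro integrableI_nonneg) (auto intro: kl_fun_nonneg coupling_density_nonneg[OF cd] simp: top.not_eq_extremum)
  then show ?thesis using that eq cd by (auto simp: finite_entropy_densities_def)
qed

lemma free_energy_nonneg:
  "0 \<le> \<beta> \<Longrightarrow> f \<in> finite_entropy_densities \<Longrightarrow> 0 \<le> free_energy \<beta> f"
  unfolding free_energy_def using cost_gain_le_max divergence_nonneg finite_entropyD by simp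

lemma min_free_energy_le:
  "0 \<le> \<beta> \<Longrightarrow> f \<in> finite_entropy_densities \<Longrightarrow> min_free_energy \<beta> \<le> free_energy \<beta> f"
  unfolding min_free_energy_def by (intro cINF_lower bdd_belowI2[where m=0] free_energy_nonneg)

lemma le_min_free_energy:
  "(\<And>f. f \<in> finite_entropy_densities \<Longrightarrow> b \<le> free_energy \<beta> f) \<Longrightarrow> b \<le> min_free_energy \<beta>"
  unfolding min_free_energy_def by (intro cINF_greatest) (use one_mem_finite_entropy in auto)

lemma near_minimiser:
  assumes "0 \<le> \<beta>" "e > 0"
  obtains f where "f \<in> finite_entropy_densities" "free_energy \<beta> f < min_free_energy \<beta> + e"
  using le_min_free_energy[of "min_free_energy \<beta> + e" \<beta>] assms by (meson add_le_same_cancel1 not_le)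

lemma free_energy_mono:
  assumes "\<beta> \<le> \<beta>'" "f \<in> finite_entropy_densities"
  shows "free_energy \<beta> f \<le> free_energy \<beta>' f"
  unfolding free_energy_def using assms cost_gain_le_max[of f] finite_entropyD(1)
  by (auto intro: mult_right_mono)

lemma min_free_energy_mono:
  assumes "0 \<le> \<beta>" "\<beta> \<le> \<beta>'"
  shows "min_free_energy \<beta> \<le> min_free_energy \<beta>'"
  by (rule le_min_free_energy) (meson assms free_energy_mono min_free_energy_le order_trans)

text \<open>Plans of infinite relative entropy contribute \<open>-\<infinity>\<close> to the supremum, and there is at least one
  plan of finite entropy, the product; as the free energy is nonnegative, the pressure is a real
  number.\<close>

lemma pressure_eq_min_free_energy:
  assumes "0 \<le> \<beta>"
  shows "pressure \<mu> \<nu> (\<lambda>p. \<beta> * A p) - ereal (\<beta> * m) = ereal (- min_free_energy \<beta>)"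
proof -
  have plan: "ereal (\<integral>p. \<beta> * A p \<partial>plan f) + plan_entropy \<mu> \<nu> (plan f) = ereal (\<beta> * m - free_energy \<beta> f)"
    if "f \<in> finite_entropy_densities" for f
    using that finite_entropyD(1)[OF that]
    by (simp add: plan_entropy_plan cost_gain_eq free_energy_def algebra_simps)
  have "pressure \<mu> \<nu> (\<lambda>p. \<beta> * A p) = ereal (\<beta> * m - min_free_energy \<beta>)"
  proof (rule antisym)
    show "pressure \<mu> \<nu> (\<lambda>p. \<beta> * A p) \<le> ereal (\<beta> * m - min_free_energy \<beta>)"
      unfolding pressure_def
    proof (rule SUP_least)
      fix \<pi> assume \<pi>: "\<pi> \<in> couplings \<mu> \<nu>"
      show "ereal (\<integral>p. \<beta> * A p \<partial>\<pi>) + plan_entropy \<mu> \<nu> \<pi> \<le> ereal (\<beta> * m - min_free_energy \<beta>)"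
      proof (cases "plan_entropy \<mu> \<nu> \<pi> = -\<infinity>")
        case False
        with \<pi> obtain f where f: "f \<in> finite_entropy_densities" "\<pi> = plan f"
          using plan_entropy_finite_cases by blast
        then show ?thesis using plan[OF f(1)] min_free_energy_le[OF assms f(1)] by simp
      qed simp
    qed
    show "ereal (\<beta> * m - min_free_energy \<beta>) \<le> pressure \<mu> \<nu> (\<lambda>p. \<beta> * A p)"
    proof (rule ereal_le_epsilon2)
      fix e :: real assume "e > 0"
      then obtain f where f: "f \<in> finite_entropy_densities" "free_energy \<beta> f < min_free_energy \<beta> + e"
        using near_minimiser assms by blast
      then have "ereal (\<beta> * m - min_free_energy \<beta>) \<le> ereal (\<beta> * m - free_energy \<beta> f) + ereal e"
        by simp
      also have "ereal (\<beta> * m - free_energy \<beta> f) \<le> pressure \<mu> \<nu> (\<lambda>p. \<beta> * A p)"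
        unfolding pressure_def plan[OF f(1), symmetric]
        using f finite_entropyD(1) by (intro SUP_upper plan_mem_couplings) auto
      then have "ereal (\<beta> * m - free_energy \<beta> f) + ereal e \<le> pressure \<mu> \<nu> (\<lambda>p. \<beta> * A p) + ereal e"
        by (intro add_right_mono)
      finally show "ereal (\<beta> * m - min_free_energy \<beta>) \<le> pressure \<mu> \<nu> (\<lambda>p. \<beta> * A p) + ereal e" .
    qed
  qed
  then show ?thesis by simp
qed

end

section \<open>Strong convexity and the zero-temperature minimiser\<close>

context transport_problem
begin

lemma midpoint_mem_finite_entropy:
  assumes f: "f \<in> finite_entropy_densities" and g: "g \<in> finite_entropy_densities"
  shows "(\<lambda>z. (f z + g z) / 2) \<in> finite_entropy_densities"
proof -
  note f' = finite_entropyD[OF f] and g' = finite_entropyD[OF g]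
  note fc = coupling_densityD[OF f'(1)] and gc = coupling_densityD[OF g'(1)]
  note [measurable] = fc(1) gc(1)
  have int: "integrable \<rho> (\<lambda>z. indicator S z * f z)" "integrable \<rho> (\<lambda>z. indicator S z * g z)"
    if "S \<in> sets borel" for S
    using that fc gc by (auto intro!: integrable_bounded_mult[where C=1] simp: indicator_def)
  have half: "(\<integral>z. indicator S z * ((f z + g z) / 2) \<partial>\<rho>) =
      ((\<integral>z. indicator S z * f z \<partial>\<rho>) + (\<integral>z. indicator S z * g z \<partial>\<rho>)) / 2"
    if "S \<in> sets borel" for S
    using int[OF that] by (simp add: distrib_left)
  have "coupling_density (\<lambda>z. (f z + g z) / 2)"
    using f'(1) g'(1) fc gc unfolding coupling_density_def
    by (auto simp: half strip_measurable simp del: times_divide_eq_right)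
  moreover have "integrable \<rho> (\<lambda>z. kl_fun ((f z + g z) / 2))"
  proof (rule Bochner_Integration.integrable_bound)
    show "integrable \<rho> (\<lambda>z. (kl_fun (f z) + kl_fun (g z)) / 2)" using f' g' by auto
    show "AE z in \<rho>. norm (kl_fun ((f z + g z) / 2)) \<le> norm ((kl_fun (f z) + kl_fun (g z)) / 2)"
    proof (intro AE_I2)
      fix z
      have "0 \<le> kl_fun (f z) + kl_fun (g z) - 2 * kl_fun ((f z + g z) / 2)"
        using kl_fun_midpoint_gap[of "f z" "g z"] fc(2)[of z] gc(2)[of z] zero_le_power2 order_trans by blast
      moreover have "0 \<le> kl_fun ((f z + g z) / 2)"
        using fc(2)[of z] gc(2)[of z] by (intro kl_fun_nonneg) simp
      ultimately show "norm (kl_fun ((f z + g z) / 2)) \<le> norm ((kl_fun (f z) + kl_fun (g z)) / 2)"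
        by simp
    qed
  qed measurable
  ultimately show ?thesis by (simp add: finite_entropy_densities_def)
qed

text \<open>The gain term of the free energy is affine, so the convexity gap of the divergence is the
  convexity gap of the free energy, and the midpoint cannot beat the minimum. Almost minimal
  densities are therefore close to each other in \<open>L\<^sup>1\<close>. This replaces compactness of the set of
  couplings.\<close>

lemma L1_dist_le_free_energy_excess:
  assumes f: "f \<in> finite_entropy_densities" and g: "g \<in> finite_entropy_densities"
    and "0 \<le> \<beta>" "0 < s"
  shows "(\<integral>z. \<bar>f z - g z\<bar> \<partial>\<rho>) \<le>
    (free_energy \<beta> f + free_energy \<beta> g - 2 * min_free_energy \<beta>) / s + 4 * s"
proof -
  let ?h = "\<lambda>z. (f z + g z) / 2"
  have h: "?h \<in> finite_entropy_densities" using midpoint_mem_finite_entropy f g .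
  note f' = finite_entropyD[OF f] and g' = finite_entropyD[OF g] and h' = finite_entropyD[OF h]
  note fc = coupling_densityD[OF f'(1)] and gc = coupling_densityD[OF g'(1)]
  note [measurable] = fc(1) gc(1)
  have "(\<integral>z. \<bar>f z - g z\<bar> \<partial>\<rho>) \<le>
      (\<integral>z. (kl_fun (f z) + kl_fun (g z) - 2 * kl_fun (?h z)) / s + s * (3 * f z + g z) \<partial>\<rho>)"
  proof (rule integral_mono)
    show "\<bar>f z - g z\<bar> \<le> (kl_fun (f z) + kl_fun (g z) - 2 * kl_fun (?h z)) / s + s * (3 * f z + g z)" for z
      using abs_diff_le_kl_fun_gap assms fc gc by blast
    show "integrable \<rho> (\<lambda>z. \<bar>f z - g z\<bar>)" using fc gc by auto
    show "integrable \<rho> (\<lambda>z. (kl_fun (f z) + kl_fun (g z) - 2 * kl_fun (?h z)) / s + s * (3 * f z + g z))"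
      using f'(2) g'(2) h'(2) fc(3) gc(3) by simp
  qed
  also have "\<dots> = (divergence f + divergence g - 2 * divergence ?h) / s + s * 4"
    using f'(2) g'(2) h'(2) fc(3) gc(3)
    by (simp add: divergence_def coupling_density_integral[OF f'(1)] coupling_density_integral[OF g'(1)])
  also have "divergence f + divergence g - 2 * divergence ?h =
      free_energy \<beta> f + free_energy \<beta> g - 2 * free_energy \<beta> ?h"
  proof -
    obtain C where C: "\<And>z. \<bar>A z\<bar> \<le> C" using A_bounded by blast
    have "integrable \<rho> (\<lambda>z. A z * f z)" "integrable \<rho> (\<lambda>z. A z * g z)"
      using fc gc C by (auto intro!: integrable_bounded_mult)
    then have "cost_gain ?h = (cost_gain f + cost_gain g) / 2"
      unfolding cost_gain_def by (simp add: distrib_left)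
    then show ?thesis unfolding free_energy_def by (simp add: field_simps)
  qed
  also have "(free_energy \<beta> f + free_energy \<beta> g - 2 * free_energy \<beta> ?h) / s \<le>
      (free_energy \<beta> f + free_energy \<beta> g - 2 * min_free_energy \<beta>) / s"
    using min_free_energy_le[OF _ h] assms by (intro divide_right_mono) auto
  finally show ?thesis by simp
qed

text \<open>Truncating the pointwise limit at \<open>0\<close> makes it nonnegative everywhere, including the null set
  where the sequence does not converge and \<open>lim\<close> is arbitrary.\<close>

lemma L1_limit_of_coupling_densities:
  fixes f :: "nat \<Rightarrow> 'x \<times> 'y \<Rightarrow> real"
  assumes f: "\<And>n. coupling_density (f n)"
    and le: "\<And>n. (\<integral>z. \<bar>f (Suc n) z - f n z\<bar> \<partial>\<rho>) \<le> c n" and c: "summable c"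
  obtains g where "coupling_density g" "AE z in \<rho>. (\<lambda>n. f n z) \<longlonglongrightarrow> g z"
    "(\<lambda>n. cost_gain (f n)) \<longlonglongrightarrow> cost_gain g"
proof -
  note fc = coupling_densityD[OF f]
  note [measurable] = fc(1)
  obtain w where w: "integrable \<rho> w" "AE z in \<rho>. \<forall>n. \<bar>f n z\<bar> \<le> w z"
    and conv: "AE z in \<rho>. convergent (\<lambda>n. f n z)"
    using summable_L1_increments_converge[OF fc(3) le c] by blast
  define g where "g z = max 0 (lim (\<lambda>n. f n z))" for z
  have [measurable]: "g \<in> borel_measurable borel" unfolding g_def by measurable
  have lim: "AE z in \<rho>. (\<lambda>n. f n z) \<longlonglongrightarrow> g z"
    using conv
  proof eventually_elim
    case (elim z)
    then have l: "(\<lambda>n. f n z) \<longlonglongrightarrow> lim (\<lambda>n. f n z)" by (simp add: convergent_LIMSEQ_iff)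
    then have "0 \<le> lim (\<lambda>n. f n z)" by (rule LIMSEQ_le_const) (use fc(2) in auto)
    then show ?case using l by (simp add: g_def)
  qed
  have int_lim: "integrable \<rho> (\<lambda>z. u z * g z) \<and> (\<lambda>n. \<integral>z. u z * f n z \<partial>\<rho>) \<longlonglongrightarrow> (\<integral>z. u z * g z \<partial>\<rho>)"
    if u[measurable]: "u \<in> borel_measurable borel" and b: "\<And>z. \<bar>u z\<bar> \<le> C" for u C
  proof -
    have 1: "(\<lambda>z. u z * g z) \<in> borel_measurable \<rho>" "\<And>n. (\<lambda>z. u z * f n z) \<in> borel_measurable \<rho>"
      "integrable \<rho> (\<lambda>z. C * w z)"
      using w(1) by simp_all
    have 2: "AE z in \<rho>. (\<lambda>n. u z * f n z) \<longlonglongrightarrow> u z * g z"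
      using lim by eventually_elim (intro tendsto_intros)
    have 3: "AE z in \<rho>. norm (u z * f n z) \<le> C * w z" for n
      using w(2) by eventually_elim
        (auto simp: abs_mult intro!: mult_mono b order_trans[OF abs_ge_zero b])
    show ?thesis
      using integrable_dominated_convergence[OF 1 2 3] integral_dominated_convergence[OF 1 2 3] by blast
  qed
  have ind: "(\<lambda>n. \<integral>z. indicator S z * f n z \<partial>\<rho>) \<longlonglongrightarrow> (\<integral>z. indicator S z * g z \<partial>\<rho>)"
    if "S \<in> sets borel" for S
    using that int_lim[of "indicator S" 1] by (auto simp: indicator_def)
  have "coupling_density g"
    unfolding coupling_density_def
  proof (intro conjI ballI allI)
    show "integrable \<rho> g" using int_lim[of "\<lambda>_. 1" 1] by simp
  next
    fix B :: "'x set" assume B: "B \<in> sets borel"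
    have "(\<lambda>n. \<integral>z. indicator (B \<times> UNIV) z * f n z \<partial>\<rho>) = (\<lambda>n. measure \<mu> B)"
      using f B unfolding coupling_density_def by auto
    then show "(\<integral>z. indicator (B \<times> UNIV) z * g z \<partial>\<rho>) = measure \<mu> B"
      using ind[OF strip_measurable(1)[OF B]] by (metis LIMSEQ_unique tendsto_const)
  next
    fix C :: "'y set" assume C: "C \<in> sets borel"
    have "(\<lambda>n. \<integral>z. indicator (UNIV \<times> C) z * f n z \<partial>\<rho>) = (\<lambda>n. measure \<nu> C)"
      using f C unfolding coupling_density_def by auto
    then show "(\<integral>z. indicator (UNIV \<times> C) z * g z \<partial>\<rho>) = measure \<nu> C"
      using ind[OF strip_measurable(2)[OF C]] by (metis LIMSEQ_unique tendsto_const)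
  qed (auto simp: g_def)
  moreover have "(\<lambda>n. cost_gain (f n)) \<longlonglongrightarrow> cost_gain g"
    unfolding cost_gain_def using int_lim[OF A_measurable] A_bounded by metis
  ultimately show ?thesis using lim that by blast
qed

text \<open>Lower semicontinuity of the divergence, by Fatou's lemma for the nonnegative integrand.\<close>

lemma divergence_AE_limit:
  assumes f: "\<And>n. f n \<in> finite_entropy_densities" and g: "coupling_density g"
    and lim: "AE z in \<rho>. (\<lambda>n. f n z) \<longlonglongrightarrow> g z"
    and le: "\<And>n. divergence (f n) \<le> b n" and b: "b \<longlonglongrightarrow> l"
  shows "g \<in> finite_entropy_densities" and "divergence g \<le> l"
proof -
  note fd = finite_entropyD[OF f]
  note fc = coupling_densityD[OF fd(1)] and gc = coupling_densityD[OF g]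
  note [measurable] = fc(1) gc(1)
  have "0 \<le> b n" for n using divergence_nonneg[OF fd(1)] le order_trans by blast
  then have l: "0 \<le> l" using b by (intro LIMSEQ_le_const) auto
  have eq: "(\<integral>\<^sup>+z. ennreal (kl_fun (f n z)) \<partial>\<rho>) = ennreal (divergence (f n))" for n
    unfolding divergence_def by (intro nn_integral_eq_integral fd(2) AE_I2 kl_fun_nonneg fc(2))
  have "(\<integral>\<^sup>+z. ennreal (kl_fun (g z)) \<partial>\<rho>) = (\<integral>\<^sup>+z. liminf (\<lambda>n. ennreal (kl_fun (f n z))) \<partial>\<rho>)"
  proof (rule nn_integral_cong_AE)
    show "AE z in \<rho>. ennreal (kl_fun (g z)) = liminf (\<lambda>n. ennreal (kl_fun (f n z)))"
      using lim
    proof eventually_elim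
      case (elim z)
      then have "(\<lambda>n. ennreal (kl_fun (f n z))) \<longlonglongrightarrow> ennreal (kl_fun (g z))"
        using fc(2) by (intro tendsto_ennrealI kl_fun_tendsto)
      then show ?case by (simp add: lim_imp_Liminf)
    qed
  qed
  also have "\<dots> \<le> liminf (\<lambda>n. \<integral>\<^sup>+z. ennreal (kl_fun (f n z)) \<partial>\<rho>)"
    by (rule nn_integral_liminf) measurable
  also have "\<dots> \<le> liminf (\<lambda>n. ennreal (b n))"
    unfolding eq by (intro Liminf_mono always_eventually) (auto intro: ennreal_leI le)
  also have "\<dots> = ennreal l"
    using b by (intro lim_imp_Liminf tendsto_ennrealI) auto
  finally have fin: "(\<integral>\<^sup>+z. ennreal (kl_fun (g z)) \<partial>\<rho>) \<le> ennreal l" .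
  have int: "integrable \<rho> (\<lambda>z. kl_fun (g z))"
    using fin by (intro integrableI_nonneg AE_I2 kl_fun_nonneg gc(2)) (auto simp: order_le_less_trans)
  then show "g \<in> finite_entropy_densities" using g by (simp add: finite_entropy_densities_def)
  have "(\<integral>\<^sup>+z. ennreal (kl_fun (g z)) \<partial>\<rho>) = ennreal (divergence g)"
    unfolding divergence_def by (intro nn_integral_eq_integral int AE_I2 kl_fun_nonneg gc(2))
  then show "divergence g \<le> l" using fin l by simp
qed

text \<open>If the minimal free energies stay bounded as \<open>\<beta> \<rightarrow> \<infinity>\<close>, choose inverse temperatures \<open>B n\<close> where
  they are within \<open>4\<^sup>-\<^sup>n\<close> of their supremum \<open>l\<close>, and almost minimal densities \<open>f n\<close>. Because the free energy of a
  fixed density increases with \<open>\<beta>\<close>, the density \<open>f (n + 1)\<close> is almost minimal at \<open>B n\<close> too, so that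
  consecutive densities are \<open>2\<^sup>-\<^sup>n\<close>-close in \<open>L\<^sup>1\<close> up to a constant.\<close>

lemma zero_temperature_minimiser:
  assumes bdd: "\<And>\<beta>. 0 < \<beta> \<Longrightarrow> min_free_energy \<beta> \<le> b"
  defines "l \<equiv> (SUP \<beta>\<in>{0<..}. min_free_energy \<beta>)"
  obtains g where "g \<in> finite_entropy_densities" "cost_gain g = m" "divergence g \<le> l"
proof -
  have bdd': "bdd_above (min_free_energy ` {0<..})" using bdd by (intro bdd_aboveI2) auto
  have le_l: "min_free_energy \<beta> \<le> l" if "0 < \<beta>" for \<beta>
    unfolding l_def using that by (intro cSUP_upper bdd') auto
  define e :: "nat \<Rightarrow> real" where "e n = (1 / 2) ^ n" for n
  have e: "0 < e n" "e n \<le> 1" "e (Suc n) \<le> e n" for n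
    by (auto simp: e_def power_le_one)
  have "\<exists>\<beta>>0. l - (e n)\<^sup>2 < min_free_energy \<beta>" for n
  proof -
    have "l - (e n)\<^sup>2 < l" using e(1)[of n] by simp
    then show ?thesis using less_cSUP_iff[OF _ bdd'] unfolding l_def by auto
  qed
  then obtain b where b: "\<And>n. 0 < b n" "\<And>n. l - (e n)\<^sup>2 < min_free_energy (b n)" by metis
  \<comment> \<open>Partial sums of the \<open>b i\<close> make the sequence monotone; the added \<open>n + 1\<close> makes it tend to infinity.\<close>
  define B where "B n = (\<Sum>i\<le>n. b i) + real n + 1" for n
  have bB: "b n \<le> B n" for n
  proof -
    have "b n \<le> (\<Sum>i\<le>n. b i)" by (rule member_le_sum) (auto intro: less_imp_le b(1))
    then show ?thesis by (simp add: B_def)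
  qed
  have B_ge: "real n + 1 \<le> B n" for n unfolding B_def using b(1) by (simp add: sum_nonneg less_imp_le)
  have B_mono: "B n \<le> B (Suc n)" for n unfolding B_def using b(1)[of "Suc n"] by simp
  have Bpos: "0 < B n" for n using b(1) bB by (rule less_le_trans)
  have EB: "l - (e n)\<^sup>2 < min_free_energy (B n)" for n
    using b(2)[of n] min_free_energy_mono[OF _ bB] b(1)[of n] by (smt (verit))
  have "\<exists>f \<in> finite_entropy_densities. free_energy (B n) f < min_free_energy (B n) + (e n)\<^sup>2" for n
    using near_minimiser[OF less_imp_le[OF Bpos] zero_less_power[OF e(1)], of n n 2] by blast
  then obtain f where f: "\<And>n. f n \<in> finite_entropy_densities"
    and fB: "\<And>n. free_energy (B n) (f n) < min_free_energy (B n) + (e n)\<^sup>2" by metis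
  note fd = finite_entropyD[OF f]
  have fl: "free_energy (B n) (f n) \<le> l + (e n)\<^sup>2" for n
    using fB[of n] le_l[OF Bpos[of n]] by simp
  have fl': "free_energy (B n) (f (Suc n)) \<le> l + (e n)\<^sup>2" for n
  proof -
    have "(e (Suc n))\<^sup>2 \<le> (e n)\<^sup>2" using e by (intro power_mono) (auto intro: less_imp_le)
    then show ?thesis using free_energy_mono[OF B_mono f, of n "Suc n"] fl[of "Suc n"] by simp
  qed
  have step: "(\<integral>z. \<bar>f (Suc n) z - f n z\<bar> \<partial>\<rho>) \<le> 8 * e n" for n
  proof -
    have "(\<integral>z. \<bar>f (Suc n) z - f n z\<bar> \<partial>\<rho>) \<le>
        (free_energy (B n) (f (Suc n)) + free_energy (B n) (f n) - 2 * min_free_energy (B n)) / e n + 4 * e n"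
      using Bpos[of n] e(1) by (intro L1_dist_le_free_energy_excess f) auto
    also have "\<dots> \<le> (4 * (e n)\<^sup>2) / e n + 4 * e n"
      using fl[of n] fl'[of n] EB[of n] e(1)[of n] by (intro add_right_mono divide_right_mono) auto
    also have "\<dots> = 8 * e n" using e(1)[of n] by (simp add: power2_eq_square)
    finally show ?thesis .
  qed
  have summ: "summable (\<lambda>n. 8 * e n)" unfolding e_def by (intro summable_mult summable_geometric) simp
  obtain g where g: "coupling_density g" "AE z in \<rho>. (\<lambda>n. f n z) \<longlonglongrightarrow> g z"
    and gain: "(\<lambda>n. cost_gain (f n)) \<longlonglongrightarrow> cost_gain g"
    using L1_limit_of_coupling_densities[OF fd(1) step summ] by blast
  have div_le: "divergence (f n) \<le> l + (e n)\<^sup>2" for n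
    using fl[of n] cost_gain_le_max[OF fd(1), of n] Bpos[of n] unfolding free_energy_def
    by (smt (verit) mult_nonneg_nonneg)
  have e0: "e \<longlonglongrightarrow> 0" unfolding e_def by (intro LIMSEQ_power_zero) simp
  have "(\<lambda>n. l + (e n)\<^sup>2) \<longlonglongrightarrow> l"
    using tendsto_add[OF tendsto_const[of l] tendsto_power[OF e0, of 2]] by simp
  note divergence_AE_limit[OF f g div_le this]
  moreover have "cost_gain g = m"
  proof (rule antisym)
    show "cost_gain g \<le> m" using g(1) by (rule cost_gain_le_max)
    have "m - (l + 1) / (real n + 1) \<le> cost_gain (f n)" for n
    proof -
      have d: "0 \<le> m - cost_gain (f n)" using cost_gain_le_max[OF fd(1)] by simp
      have "(m - cost_gain (f n)) * (real n + 1) \<le> (m - cost_gain (f n)) * B n"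
        using d B_ge by (intro mult_left_mono)
      also have "\<dots> \<le> free_energy (B n) (f n)"
        using divergence_nonneg[OF fd(1)] by (simp add: free_energy_def mult.commute)
      also have "\<dots> \<le> l + 1"
        using fl[of n] e(1,2)[of n] power_le_one[of "e n" 2] by simp
      finally have "m - cost_gain (f n) \<le> (l + 1) / (real n + 1)" by (simp add: pos_le_divide_eq)
      then show ?thesis by simp
    qed
    moreover have "(\<lambda>n. m - (l + 1) / (real n + 1)) \<longlonglongrightarrow> m - 0"
      using LIMSEQ_Suc[OF lim_const_over_n[of "l + 1"]] by (intro tendsto_diff tendsto_const) (simp add: add.commute)
    ultimately show "m \<le> cost_gain g" using LIMSEQ_le gain by fastforce
  qed
  ultimately show ?thesis using that by blast
qed

end

section \<open>Approximation by plans of finite entropy\<close>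

text \<open>Assigning to each point the first centre of a finite cover that is close to it yields a
  measurable labelling; its fibres are the cells of the partition.\<close>

lemma compact_finite_borel_partition:
  fixes d :: real
  assumes "compact (UNIV :: 'a::metric_space set)" "d > 0"
  obtains n :: nat and i :: "'a::metric_space \<Rightarrow> nat" and c :: "nat \<Rightarrow> 'a::metric_space"
  where "i \<in> borel \<rightarrow>\<^sub>M count_space UNIV" "\<And>x. i x < n" "\<And>x. dist x (c (i x)) < d"
proof -
  obtain K :: "'a set" where K: "finite K" "UNIV \<subseteq> (\<Union>x\<in>K. ball x d)"
    using assms unfolding compact_eq_totally_bounded by blast
  obtain xs where xs: "set xs = K" using K(1) finite_list by blast
  define P where "P k x \<longleftrightarrow> k < length xs \<and> dist x (xs ! k) < d" for k x
  have ex: "\<exists>k. P k x" for x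
  proof -
    obtain y where "y \<in> K" "dist y x < d" using K(2) by (auto simp: subset_eq)
    then show ?thesis using xs unfolding P_def by (metis dist_commute in_set_conv_nth)
  qed
  have [measurable]: "Measurable.pred borel (P k)" for k
  proof -
    have "{x. P k x} = (if k < length xs then ball (xs ! k) d else {})"
      by (auto simp: P_def dist_commute)
    then show ?thesis by (simp add: pred_def)
  qed
  have "P (LEAST k. P k x) x" for x using ex by (rule LeastI_ex)
  then show ?thesis
    by (intro that[of "\<lambda>x. LEAST k. P k x" "length xs" "(!) xs"]) (measurable, auto simp: P_def)
qed

lemma (in finite_measure) measure_eq_sum_fibres:
  fixes i :: "'a \<Rightarrow> nat"
  assumes [measurable]: "i \<in> M \<rightarrow>\<^sub>M count_space UNIV" "B \<in> sets M" and "\<And>x. i x < n"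
  shows "measure M B = (\<Sum>a<n. measure M (B \<inter> i -` {a}))"
proof -
  have "B \<inter> i -` {a} = B \<inter> (i -` {a} \<inter> space M)" for a
    using sets.sets_into_space[OF assms(2)] by auto
  then have [measurable]: "B \<inter> i -` {a} \<in> sets M" for a
    by (metis assms(1,2) measurable_sets sets.Int UNIV_I sets_count_space subset_UNIV Pow_iff)
  have "B = (\<Union>a<n. B \<inter> i -` {a})" using assms(3) by auto
  then have "measure M B = measure M (\<Union>a<n. B \<inter> i -` {a})" by simp
  also have "\<dots> = (\<Sum>a<n. measure M (B \<inter> i -` {a}))"
    by (rule finite_measure_finite_Union) (auto simp: disjoint_family_on_def)
  finally show ?thesis .
qed

lemma (in finite_measure) integral_double_sum_indicator:
  fixes h :: "nat \<Rightarrow> nat \<Rightarrow> real"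
  assumes R: "\<And>a b. R a b \<in> sets M"
  shows "(\<integral>z. (\<Sum>a<n. \<Sum>b<k. h a b * indicator (R a b) z) \<partial>M) =
    (\<Sum>a<n. \<Sum>b<k. h a b * measure M (R a b))"
proof -
  have i: "integrable M (\<lambda>z. h a b * indicator (R a b) z)" for a b
    using R by (intro integrable_mult_right integrable_real_indicator) (auto simp: less_top[symmetric])
  have v: "(\<integral>z. h a b * indicator (R a b) z \<partial>M) = h a b * measure M (R a b)" for a b
    using sets.sets_into_space[OF R] by (simp add: Int_absorb2)
  have "(\<integral>z. (\<Sum>a<n. \<Sum>b<k. h a b * indicator (R a b) z) \<partial>M) =
      (\<Sum>a<n. \<integral>z. (\<Sum>b<k. h a b * indicator (R a b) z) \<partial>M)"
    by (intro Bochner_Integration.integral_sum Bochner_Integration.integrable_sum i)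
  also have "\<dots> = (\<Sum>a<n. \<Sum>b<k. \<integral>z. h a b * indicator (R a b) z \<partial>M)"
    by (intro sum.cong refl Bochner_Integration.integral_sum i)
  finally show ?thesis unfolding v .
qed

context transport_problem
begin

text \<open>Block averaging: inside every cell of a finite product partition, the mass that \<open>\<pi>\<close> gives to the
  cell is spread proportionally to \<open>\<mu> \<times> \<nu>\<close>. The marginals do not change, the density takes finitely
  many values, and mass moves only within the cells, so that the integral of \<open>A\<close> changes little
  when the cells are small. Cells of measure zero are harmless thanks to \<open>x / 0 = 0\<close>.\<close>

lemma finite_entropy_approximation:
  assumes \<pi>: "\<pi> \<in> couplings \<mu> \<nu>" and "e > 0"
  obtains f where "f \<in> finite_entropy_densities" "(\<integral>z. A z \<partial>\<pi>) - e \<le> cost_gain f"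
proof -
  interpret \<pi>: prob_space \<pi> using \<pi> by (rule couplings_prob)
  have [measurable_cong]: "sets \<pi> = sets borel" and sp\<pi>: "space \<pi> = UNIV"
    using \<pi> couplings_sets couplings_space by auto
  have "uniformly_continuous_on UNIV A"
    using compact_XY continuous_A by (intro compact_uniformly_continuous)
  then obtain \<delta> where \<delta>: "\<delta> > 0" "\<And>z z'. dist z z' < \<delta> \<Longrightarrow> dist (A z) (A z') < e / 2"
    unfolding uniformly_continuous_on_def using \<open>e > 0\<close> by (metis UNIV_I half_gt_zero dist_commute)
  obtain n and i :: "'x \<Rightarrow> nat" and c where i[measurable]: "i \<in> borel \<rightarrow>\<^sub>M count_space UNIV" and i_less: "\<And>x. i x < n"
    and c: "\<And>x. dist x (c (i x)) < \<delta> / 2"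
    using compact_finite_borel_partition[OF compact_X half_gt_zero[OF \<delta>(1)]] by metis
  obtain k and j :: "'y \<Rightarrow> nat" and d where j[measurable]: "j \<in> borel \<rightarrow>\<^sub>M count_space UNIV" and j_less: "\<And>y. j y < k"
    and d: "\<And>y. dist y (d (j y)) < \<delta> / 2"
    using compact_finite_borel_partition[OF compact_Y half_gt_zero[OF \<delta>(1)]] by metis
  define X where "X a = i -` {a}" for a
  define Y where "Y b = j -` {b}" for b
  have X[measurable]: "X a \<in> sets borel" for a
    using measurable_sets[OF i, of "{a}"] by (simp add: X_def)
  have Y[measurable]: "Y b \<in> sets borel" for b
    using measurable_sets[OF j, of "{b}"] by (simp add: Y_def)
  have rect[measurable]: "S \<times> T \<in> sets (borel :: ('x \<times> 'y) measure)"
    if "S \<in> sets borel" "T \<in> sets borel" for S T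
    using that by (auto simp flip: sets_\<rho> intro!: pair_measureI simp: sets_\<mu> sets_\<nu>)
  have measure_rect: "measure \<rho> (S \<times> T) = measure \<mu> S * measure \<nu> T"
    if "S \<in> sets borel" "T \<in> sets borel" for S T
    using that by (simp add: measure_def M2.emeasure_pair_measure_Times sets_\<mu> sets_\<nu> enn2real_mult)
  define Q where "Q a b = measure \<pi> (X a \<times> Y b)" for a b
  define w where "w a b = Q a b / (measure \<mu> (X a) * measure \<nu> (Y b))" for a b
  define f where "f z = w (i (fst z)) (j (snd z))" for z
  have fiX[measurable]: "(\<lambda>z. i (fst z)) \<in> (borel :: ('x \<times> 'y) measure) \<rightarrow>\<^sub>M count_space UNIV"
    by (rule measurable_compose[OF measurable_fst_borel i])
  have fjY[measurable]: "(\<lambda>z. j (snd z)) \<in> (borel :: ('x \<times> 'y) measure) \<rightarrow>\<^sub>M count_space UNIV"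
    by (rule measurable_compose[OF measurable_snd_borel j])
  have Q_X: "(\<Sum>b<k. Q a b) = measure \<mu> (X a)" for a
  proof -
    have "measure \<mu> (X a) = measure \<pi> (X a \<times> UNIV)"
      using couplings_emeasure(1)[OF \<pi> X] by (simp add: measure_def)
    also have "\<dots> = (\<Sum>b<k. measure \<pi> (X a \<times> UNIV \<inter> (\<lambda>z. j (snd z)) -` {b}))"
      by (rule \<pi>.measure_eq_sum_fibres) (measurable, simp add: j_less)
    also have "\<dots> = (\<Sum>b<k. Q a b)"
      unfolding Q_def Y_def by (intro sum.cong refl arg_cong[where f="measure \<pi>"]) auto
    finally show ?thesis by simp
  qed
  have Q_Y: "(\<Sum>a<n. Q a b) = measure \<nu> (Y b)" for b
  proof -
    have "measure \<nu> (Y b) = measure \<pi> (UNIV \<times> Y b)"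
      using couplings_emeasure(2)[OF \<pi> Y] by (simp add: measure_def)
    also have "\<dots> = (\<Sum>a<n. measure \<pi> (UNIV \<times> Y b \<inter> (\<lambda>z. i (fst z)) -` {a}))"
      by (rule \<pi>.measure_eq_sum_fibres) (measurable, simp add: i_less)
    also have "\<dots> = (\<Sum>a<n. Q a b)"
      unfolding Q_def X_def by (intro sum.cong refl arg_cong[where f="measure \<pi>"]) auto
    finally show ?thesis by simp
  qed
  have Q_nn: "0 \<le> Q a b" for a b by (simp add: Q_def)
  have Q_out: "Q a b = 0" if "\<not> a < n \<or> \<not> b < k" for a b
  proof -
    have "X a = {} \<or> Y b = {}" using that i_less j_less by (auto simp: X_def Y_def)
    then show ?thesis by (auto simp: Q_def)
  qed
  have Q_le: "Q a b \<le> measure \<mu> (X a)" "Q a b \<le> measure \<nu> (Y b)" for a b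
  proof -
    show "Q a b \<le> measure \<mu> (X a)"
      using member_le_sum[of b "{..<k}" "Q a"] Q_X[of a] Q_nn Q_out[of a b] by (cases "b < k") auto
    show "Q a b \<le> measure \<nu> (Y b)"
      using member_le_sum[of a "{..<n}" "\<lambda>a. Q a b"] Q_Y[of b] Q_nn Q_out[of a b] by (cases "a < n") auto
  qed
  have w_mass: "w a b * (measure \<mu> (X a) * measure \<nu> (Y b)) = Q a b" for a b
    using Q_le[of a b] Q_nn[of a b] by (auto simp: w_def)
  have f_meas: "f \<in> borel_measurable borel"
    unfolding f_def by (rule measurable_compose[OF measurable_Pair[OF fiX fjY], of "\<lambda>p. w (fst p) (snd p)", simplified])
      (auto simp: pair_measure_countable)
  have f_nn: "0 \<le> f z" for z by (simp add: f_def w_def Q_nn)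
  have bound: "\<bar>h (i (fst z)) (j (snd z))\<bar> \<le> (\<Sum>p\<in>{..<n} \<times> {..<k}. \<bar>h (fst p) (snd p)\<bar>)"
    for h :: "nat \<Rightarrow> nat \<Rightarrow> real" and z
    using member_le_sum[of "(i (fst z), j (snd z))" "{..<n} \<times> {..<k}" "\<lambda>p. \<bar>h (fst p) (snd p)\<bar>"]
    by (simp add: i_less j_less)
  note [measurable] = f_meas
  have f_int: "integrable \<rho> f"
    using bound[of w] by (intro P.integrable_const_bound[where B="\<Sum>p\<in>{..<n} \<times> {..<k}. \<bar>w (fst p) (snd p)\<bar>"])
      (auto simp: f_def[symmetric])
  have kl_int: "integrable \<rho> (\<lambda>z. kl_fun (f z))"
    using bound[of "\<lambda>a b. kl_fun (w a b)"]
    by (intro P.integrable_const_bound[where B="\<Sum>p\<in>{..<n} \<times> {..<k}. \<bar>kl_fun (w (fst p) (snd p))\<bar>"])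
      (auto simp: f_def[symmetric])
  have expand: "indicator (S \<times> T) z * h (i (fst z)) (j (snd z)) =
      (\<Sum>a<n. \<Sum>b<k. h a b * indicator ((S \<inter> X a) \<times> (T \<inter> Y b)) z)"
    for h :: "nat \<Rightarrow> nat \<Rightarrow> real" and z S T
  proof -
    have "(\<Sum>a<n. \<Sum>b<k. h a b * indicator ((S \<inter> X a) \<times> (T \<inter> Y b)) z) =
        (\<Sum>a<n. if a = i (fst z) then \<Sum>b<k. if b = j (snd z) then h a b * indicator (S \<times> T) z else 0 else 0)"
      by (intro sum.cong refl) (auto simp: X_def Y_def indicator_def mem_Times_iff intro!: sum.cong)
    then show ?thesis by (simp add: sum.delta i_less j_less)
  qed
  have int_\<rho>: "(\<integral>z. indicator (S \<times> T) z * h (i (fst z)) (j (snd z)) \<partial>\<rho>) =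
      (\<Sum>a<n. \<Sum>b<k. h a b * (measure \<mu> (S \<inter> X a) * measure \<nu> (T \<inter> Y b)))"
    if [measurable]: "S \<in> sets borel" "T \<in> sets borel" for h :: "nat \<Rightarrow> nat \<Rightarrow> real" and S T
  proof -
    have "(\<integral>z. indicator (S \<times> T) z * h (i (fst z)) (j (snd z)) \<partial>\<rho>) =
        (\<Sum>a<n. \<Sum>b<k. h a b * measure \<rho> ((S \<inter> X a) \<times> (T \<inter> Y b)))"
      unfolding expand by (rule P.integral_double_sum_indicator) measurable
    then show ?thesis by (simp add: measure_rect)
  qed
  have int_\<pi>: "(\<integral>z. h (i (fst z)) (j (snd z)) \<partial>\<pi>) = (\<Sum>a<n. \<Sum>b<k. h a b * Q a b)"
    for h :: "nat \<Rightarrow> nat \<Rightarrow> real"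
  proof -
    have "(\<integral>z. h (i (fst z)) (j (snd z)) \<partial>\<pi>) =
        (\<integral>z. (\<Sum>a<n. \<Sum>b<k. h a b * indicator ((UNIV \<inter> X a) \<times> (UNIV \<inter> Y b)) z) \<partial>\<pi>)"
      unfolding expand[symmetric] by simp
    also have "\<dots> = (\<Sum>a<n. \<Sum>b<k. h a b * measure \<pi> ((UNIV \<inter> X a) \<times> (UNIV \<inter> Y b)))"
      by (rule \<pi>.integral_double_sum_indicator) measurable
    finally show ?thesis by (simp add: Q_def)
  qed
  have borel_UNIV: "UNIV \<in> sets borel" by simp
  have cd: "coupling_density f"
    unfolding coupling_density_def
  proof (intro conjI ballI allI f_meas f_nn f_int)
    fix B :: "'x set" assume B[measurable]: "B \<in> sets borel"
    have "(\<integral>z. indicator (B \<times> UNIV) z * f z \<partial>\<rho>) =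
        (\<Sum>a<n. measure \<mu> (B \<inter> X a) * (\<Sum>b<k. w a b * measure \<nu> (Y b)))"
      unfolding f_def int_\<rho>[OF B borel_UNIV]
      by (simp add: sum_distrib_left mult_ac)
    also have "\<dots> = (\<Sum>a<n. measure \<mu> (B \<inter> X a))"
    proof (rule sum.cong[OF refl])
      fix a
      have le: "measure \<mu> (B \<inter> X a) \<le> measure \<mu> (X a)"
        by (rule M1.finite_measure_mono) auto
      show "measure \<mu> (B \<inter> X a) * (\<Sum>b<k. w a b * measure \<nu> (Y b)) = measure \<mu> (B \<inter> X a)"
      proof (cases "measure \<mu> (X a) = 0")
        case True
        then show ?thesis using le measure_nonneg[of \<mu> "B \<inter> X a"] by simp
      next
        case False
        have "measure \<mu> (X a) * (\<Sum>b<k. w a b * measure \<nu> (Y b)) = measure \<mu> (X a)"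
          using Q_X[of a] w_mass[of a] by (simp add: sum_distrib_left mult_ac)
        with False show ?thesis by simp
      qed
    qed
    also have "\<dots> = measure \<mu> B"
      unfolding X_def by (rule M1.measure_eq_sum_fibres[symmetric]) (auto simp: i_less)
    finally show "(\<integral>z. indicator (B \<times> UNIV) z * f z \<partial>\<rho>) = measure \<mu> B" .
  next
    fix C :: "'y set" assume C[measurable]: "C \<in> sets borel"
    have "(\<integral>z. indicator (UNIV \<times> C) z * f z \<partial>\<rho>) =
        (\<Sum>b<k. \<Sum>a<n. w a b * (measure \<mu> (X a) * measure \<nu> (C \<inter> Y b)))"
      unfolding f_def int_\<rho>[OF borel_UNIV C] by (subst sum.swap) simp
    also have "\<dots> = (\<Sum>b<k. measure \<nu> (C \<inter> Y b) * (\<Sum>a<n. w a b * measure \<mu> (X a)))"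
      by (simp add: sum_distrib_left mult_ac)
    also have "\<dots> = (\<Sum>b<k. measure \<nu> (C \<inter> Y b))"
    proof (rule sum.cong[OF refl])
      fix b
      have le: "measure \<nu> (C \<inter> Y b) \<le> measure \<nu> (Y b)"
        by (rule M2.finite_measure_mono) auto
      show "measure \<nu> (C \<inter> Y b) * (\<Sum>a<n. w a b * measure \<mu> (X a)) = measure \<nu> (C \<inter> Y b)"
      proof (cases "measure \<nu> (Y b) = 0")
        case True
        then show ?thesis using le measure_nonneg[of \<nu> "C \<inter> Y b"] by simp
      next
        case False
        have "measure \<nu> (Y b) * (\<Sum>a<n. w a b * measure \<mu> (X a)) = measure \<nu> (Y b)"
          using Q_Y[of b] w_mass[of _ b] by (simp add: sum_distrib_left mult_ac)
        with False show ?thesis by simp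
      qed
    qed
    also have "\<dots> = measure \<nu> C"
      unfolding Y_def by (rule M2.measure_eq_sum_fibres[symmetric]) (auto simp: j_less)
    finally show "(\<integral>z. indicator (UNIV \<times> C) z * f z \<partial>\<rho>) = measure \<nu> C" .
  qed
  \<comment> \<open>\<open>h\<close> is \<open>A\<close> sampled at the centres of the cells. Its integral is the same for \<open>\<pi>\<close> and for the
    block average, since both give equal mass to every cell.\<close>
  define h where "h a b = A (c a, d b)" for a b
  have close: "\<bar>A z - h (i (fst z)) (j (snd z))\<bar> \<le> e / 2" for z
  proof -
    have "dist z (c (i (fst z)), d (j (snd z))) \<le> dist (fst z) (c (i (fst z))) + dist (snd z) (d (j (snd z)))"
      by (cases z) (simp add: dist_Pair_Pair sqrt_sum_squares_le_sum)
    also have "\<dots> < \<delta>" using c[of "fst z"] d[of "snd z"] by simp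
    finally show ?thesis using \<delta>(2) unfolding h_def dist_real_def by fastforce
  qed
  have h_meas[measurable]: "(\<lambda>z. h (i (fst z)) (j (snd z))) \<in> borel_measurable borel"
    by (rule measurable_compose[OF measurable_Pair[OF fiX fjY], of "\<lambda>p. h (fst p) (snd p)", simplified])
      (auto simp: pair_measure_countable)
  obtain CA where CA: "\<And>z. \<bar>A z\<bar> \<le> CA" using A_bounded by blast
  have h_\<pi>: "integrable \<pi> (\<lambda>z. h (i (fst z)) (j (snd z)))"
    using bound[of h] by (intro \<pi>.integrable_const_bound[where B="\<Sum>p\<in>{..<n} \<times> {..<k}. \<bar>h (fst p) (snd p)\<bar>"]) auto
  have "(\<integral>z. A z \<partial>\<pi>) \<le> (\<integral>z. h (i (fst z)) (j (snd z)) + e / 2 \<partial>\<pi>)"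
  proof (rule integral_mono)
    show "integrable \<pi> A"
      by (rule \<pi>.integrable_const_bound[where B=CA]) (auto intro: CA)
    show "integrable \<pi> (\<lambda>z. h (i (fst z)) (j (snd z)) + e / 2)"
      using h_\<pi> by simp
    show "A z \<le> h (i (fst z)) (j (snd z)) + e / 2" for z using close[of z] by linarith
  qed
  also have "\<dots> = (\<Sum>a<n. \<Sum>b<k. h a b * Q a b) + e / 2"
    using h_\<pi> \<pi>.prob_space by (simp add: int_\<pi>)
  also have "(\<Sum>a<n. \<Sum>b<k. h a b * Q a b) = (\<integral>z. h (i (fst z)) (j (snd z)) * f z \<partial>\<rho>)"
    using int_\<rho>[of UNIV UNIV "\<lambda>a b. h a b * w a b"]
    by (simp add: f_def mult.assoc w_mass)
  also have "\<dots> \<le> (\<integral>z. A z * f z + e / 2 * f z \<partial>\<rho>)"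
  proof (rule integral_mono)
    show "integrable \<rho> (\<lambda>z. h (i (fst z)) (j (snd z)) * f z)"
      using bound[of h] by (intro integrable_bounded_mult f_int h_meas)
    show "integrable \<rho> (\<lambda>z. A z * f z + e / 2 * f z)"
      using f_int by (intro Bochner_Integration.integrable_add integrable_bounded_mult[OF f_int A_measurable CA]) simp
    show "h (i (fst z)) (j (snd z)) * f z \<le> A z * f z + e / 2 * f z" for z
    proof -
      have "h (i (fst z)) (j (snd z)) \<le> A z + e / 2" using close[of z] by linarith
      then show ?thesis using f_nn[of z] by (metis distrib_right mult_right_mono)
    qed
  qed
  also have "\<dots> = cost_gain f + e / 2"
    using f_int integrable_bounded_mult[OF f_int A_measurable CA] coupling_density_integral[OF cd]
    by (simp add: cost_gain_def)
  finally have "(\<integral>z. A z \<partial>\<pi>) - e \<le> cost_gain f" by simp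
  then show ?thesis using that[of f] cd kl_int by (simp add: finite_entropy_densities_def)
qed

lemma finite_entropy_near_max:
  assumes "e > 0"
  obtains f where "f \<in> finite_entropy_densities" "m - e \<le> cost_gain f"
proof -
  have "m - e / 2 < m" using assms by simp
  moreover have "couplings \<mu> \<nu> \<noteq> {}"
    using plan_mem_couplings finite_entropyD(1)[OF one_mem_finite_entropy] by blast
  moreover have "bdd_above ((\<lambda>\<pi>. \<integral>z. A z \<partial>\<pi>) ` couplings \<mu> \<nu>)"
    using integral_A_le_max by (intro bdd_aboveI2)
  ultimately obtain \<pi> where \<pi>: "\<pi> \<in> couplings \<mu> \<nu>" "m - e / 2 < (\<integral>z. A z \<partial>\<pi>)"
    unfolding max_integral_def[of \<mu> \<nu> A] by (subst (asm) less_cSUP_iff) auto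
  obtain f where "f \<in> finite_entropy_densities" "(\<integral>z. A z \<partial>\<pi>) - e / 2 \<le> cost_gain f"
    using finite_entropy_approximation[OF \<pi>(1), of "e / 2"] assms by auto
  then show ?thesis using that \<pi>(2) by (smt (verit) field_sum_of_halves)
qed

end

section \<open>Gibbs plans minimise the free energy\<close>

context transport_problem
begin

lemma \<rho>_borel_probs: "\<rho> \<in> borel_probs"
  using P.prob_space_axioms sets_\<rho> by (simp add: borel_probs_def)

lemma continuous_fst_function: "continuous_on UNIV \<phi> \<Longrightarrow> continuous_on UNIV (\<lambda>z :: 'x \<times> 'y. \<phi> (fst z) :: real)"
  by (rule continuous_on_compose2[OF _ continuous_on_fst[OF continuous_on_id]]) auto

lemma continuous_snd_function: "continuous_on UNIV \<psi> \<Longrightarrow> continuous_on UNIV (\<lambda>z :: 'x \<times> 'y. \<psi> (snd z) :: real)"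
  by (rule continuous_on_compose2[OF _ continuous_on_snd[OF continuous_on_id]]) auto

text \<open>Functions of one variable have the same integral for all couplings.\<close>

lemma integral_couplings_marginal:
  fixes \<phi> :: "'x \<Rightarrow> real" and \<psi> :: "'y \<Rightarrow> real"
  assumes \<pi>: "\<pi> \<in> couplings \<mu> \<nu>"
  shows "continuous_on UNIV \<phi> \<Longrightarrow> (\<integral>z. \<phi> (fst z) \<partial>\<pi>) = (\<integral>x. \<phi> x \<partial>\<mu>)"
    and "continuous_on UNIV \<psi> \<Longrightarrow> (\<integral>z. \<psi> (snd z) \<partial>\<pi>) = (\<integral>y. \<psi> y \<partial>\<nu>)"
proof -
  have [measurable_cong]: "sets \<pi> = sets borel" using \<pi> by (rule couplings_sets)
  have d: "distr \<pi> borel fst = \<mu>" "distr \<pi> borel snd = \<nu>" using \<pi> by (auto simp: couplings_def)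
  show "(\<integral>z. \<phi> (fst z) \<partial>\<pi>) = (\<integral>x. \<phi> x \<partial>\<mu>)" if "continuous_on UNIV \<phi>"
    unfolding d(1)[symmetric]
    by (rule integral_distr[symmetric]) (use that in \<open>auto intro: borel_measurable_continuous_onI\<close>)
  show "(\<integral>z. \<psi> (snd z) \<partial>\<pi>) = (\<integral>y. \<psi> y \<partial>\<nu>)" if "continuous_on UNIV \<psi>"
    unfolding d(2)[symmetric]
    by (rule integral_distr[symmetric]) (use that in \<open>auto intro: borel_measurable_continuous_onI\<close>)
qed

text \<open>With \<open>h\<close> the exponent of the Gibbs density \<open>exp h\<close>, the integral of \<open>h\<close> against a coupling is
  \<open>\<beta>\<close> times the gain plus a constant \<open>K\<close> that depends on the marginals only. Hence the free energy is
  \<open>\<integral> (kl_fun f - h f)\<close> up to a constant, and pointwise \<open>f = exp h\<close> minimises the integrand.\<close>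

lemma gibbs_plan_minimises:
  assumes np: "normalizing_pair \<mu> \<nu> (\<lambda>p. \<beta> * A p) \<phi> \<psi>" and "0 \<le> \<beta>"
  obtains g where "gibbs_plan \<mu> \<nu> (\<lambda>p. \<beta> * A p) \<phi> \<psi> = plan g" "g \<in> finite_entropy_densities"
    "free_energy \<beta> g = min_free_energy \<beta>"
proof -
  have cont: "continuous_on UNIV \<phi>" "continuous_on UNIV \<psi>"
    and norm_y: "\<And>y. (\<integral>x. exp (\<beta> * A (x, y) + \<phi> x + \<psi> y) \<partial>\<mu>) = 1"
    and norm_x: "\<And>x. (\<integral>y. exp (\<beta> * A (x, y) + \<phi> x + \<psi> y) \<partial>\<nu>) = 1"
    using np by (auto simp: normalizing_pair_def)
  define h where "h z = \<beta> * A z + \<phi> (fst z) + \<psi> (snd z)" for z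
  define g where "g z = exp (h z)" for z
  note cm = continuous_fst_function[OF cont(1)] continuous_snd_function[OF cont(2)]
  have h_cont: "continuous_on UNIV h" unfolding h_def by (intro continuous_intros continuous_A cm)
  have g_cont: "continuous_on UNIV g" unfolding g_def by (intro continuous_intros h_cont)
  have [measurable]: "h \<in> borel_measurable borel" "g \<in> borel_measurable borel"
    using h_cont g_cont by (auto intro: borel_measurable_continuous_onI)
  obtain H where H: "\<And>z. \<bar>h z\<bar> \<le> H" using compact_UNIV_continuous_bounded[OF compact_XY h_cont] by blast
  have g_int: "integrable \<rho> g" by (rule integrable_continuous[OF compact_XY g_cont \<rho>_borel_probs])
  have g_ind: "integrable \<rho> (\<lambda>z. indicator S z * g z)" if "S \<in> sets borel" for S
    using that by (intro integrable_bounded_mult[OF g_int, where C=1]) (auto simp: indicator_def)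
  have cd: "coupling_density g"
    unfolding coupling_density_def
  proof (intro conjI ballI allI g_int)
    fix B :: "'x set" assume B: "B \<in> sets borel"
    have "(\<integral>z. indicator (B \<times> UNIV) z * g z \<partial>\<rho>) = (\<integral>x. \<integral>y. indicator (B \<times> UNIV) (x, y) * g (x, y) \<partial>\<nu> \<partial>\<mu>)"
      by (rule integral_fst'[symmetric]) (rule g_ind[OF strip_measurable(1)[OF B]])
    also have "\<dots> = (\<integral>x. indicator B x \<partial>\<mu>)"
      by (intro Bochner_Integration.integral_cong refl)
        (simp add: indicator_times g_def h_def norm_x)
    also have "\<dots> = measure \<mu> B" by simp
    finally show "(\<integral>z. indicator (B \<times> UNIV) z * g z \<partial>\<rho>) = measure \<mu> B" .
  next
    fix C :: "'y set" assume C: "C \<in> sets borel"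
    have "(\<integral>z. indicator (UNIV \<times> C) z * g z \<partial>\<rho>) =
        (\<integral>z. (case z of (x, y) \<Rightarrow> indicator (UNIV \<times> C) (x, y) * g (x, y)) \<partial>\<rho>)"
      by (intro Bochner_Integration.integral_cong) auto
    also have "\<dots> = (\<integral>y. \<integral>x. indicator (UNIV \<times> C) (x, y) * g (x, y) \<partial>\<mu> \<partial>\<nu>)"
      by (rule integral_snd[symmetric]) (use g_ind[OF strip_measurable(2)[OF C]] in \<open>simp add: case_prod_unfold\<close>)
    also have "\<dots> = (\<integral>y. indicator C y \<partial>\<nu>)"
      by (intro Bochner_Integration.integral_cong refl)
        (simp add: indicator_times g_def h_def norm_y)
    also have "\<dots> = measure \<nu> C" by simp
    finally show "(\<integral>z. indicator (UNIV \<times> C) z * g z \<partial>\<rho>) = measure \<nu> C" .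
  qed (auto simp: g_def)
  have kl_g: "kl_fun (g z) = h z * g z - g z + 1" for z
    by (simp add: kl_fun_def g_def mult.commute)
  have hg_int: "integrable \<rho> (\<lambda>z. h z * g z)" by (rule integrable_bounded_mult[OF g_int _ H]) measurable
  have gS: "g \<in> finite_entropy_densities"
    using cd hg_int g_int by (simp add: finite_entropy_densities_def kl_g)
  define K where "K = (\<integral>x. \<phi> x \<partial>\<mu>) + (\<integral>y. \<psi> y \<partial>\<nu>)"
  have h_integral: "(\<integral>z. h z * f z \<partial>\<rho>) = \<beta> * cost_gain f + K" if f: "coupling_density f" for f
  proof -
    have pf: "plan f \<in> borel_probs" using plan_mem_couplings[OF f] by (simp add: couplings_def)
    have "(\<integral>z. h z * f z \<partial>\<rho>) = (\<integral>z. h z \<partial>plan f)" by (rule integral_plan[OF f, symmetric]) measurable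
    also have "\<dots> = \<beta> * (\<integral>z. A z \<partial>plan f) + (\<integral>z. \<phi> (fst z) \<partial>plan f) + (\<integral>z. \<psi> (snd z) \<partial>plan f)"
      unfolding h_def using integrable_continuous[OF compact_XY _ pf] continuous_A cm by simp
    finally show ?thesis
      using integral_couplings_marginal[OF plan_mem_couplings[OF f]] cont by (simp add: cost_gain_eq f K_def)
  qed
  have "divergence g = (\<integral>z. h z * g z \<partial>\<rho>)"
    unfolding divergence_def kl_g using hg_int g_int coupling_density_integral[OF cd] P.prob_space by simp
  then have "divergence g = \<beta> * cost_gain g + K" unfolding h_integral[OF cd] .
  then have free_g: "free_energy \<beta> g = \<beta> * m + K"
    by (simp add: free_energy_def algebra_simps)
  have "free_energy \<beta> g \<le> free_energy \<beta> f" if f: "f \<in> finite_entropy_densities" for f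
  proof -
    note f' = finite_entropyD[OF f] and fc = coupling_densityD[OF finite_entropyD(1)[OF f]]
    have hf: "integrable \<rho> (\<lambda>z. h z * f z)" by (rule integrable_bounded_mult[OF fc(3) _ H]) measurable
    have "(\<integral>z. 1 - g z \<partial>\<rho>) \<le> (\<integral>z. kl_fun (f z) - h z * f z \<partial>\<rho>)"
    proof (rule integral_mono)
      show "1 - g z \<le> kl_fun (f z) - h z * f z" for z
        unfolding g_def using fc(2) by (rule kl_fun_fenchel)
    qed (use g_int f'(2) hf in simp_all)
    then have "0 \<le> divergence f - (\<beta> * cost_gain f + K)"
      using g_int f'(2) hf coupling_density_integral[OF cd] P.prob_space h_integral[OF f'(1)]
      by (simp add: divergence_def)
    then show ?thesis unfolding free_g by (simp add: free_energy_def algebra_simps)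
  qed
  then have "free_energy \<beta> g = min_free_energy \<beta>"
    using min_free_energy_le[OF \<open>0 \<le> \<beta>\<close> gS] le_min_free_energy by (intro antisym) auto
  moreover have "gibbs_plan \<mu> \<nu> (\<lambda>p. \<beta> * A p) \<phi> \<psi> = plan g"
    unfolding gibbs_plan_def by (intro arg_cong[where f="density \<rho>"] ext) (auto simp: g_def h_def)
  ultimately show ?thesis using that gS by blast
qed

text \<open>Comparing with one density of finite divergence whose gain is within \<open>e / 2\<close> of the maximum
  shows \<open>min_free_energy \<beta> \<le> \<beta> * e / 2 + O(1)\<close>, hence the gain defect of a minimiser is at most
  \<open>e / 2 + O(1 / \<beta>)\<close>.\<close>

lemma minimisers_gain_tendsto_max:
  assumes g: "\<And>\<beta>. 0 < \<beta> \<Longrightarrow> g \<beta> \<in> finite_entropy_densities"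
    "\<And>\<beta>. 0 < \<beta> \<Longrightarrow> free_energy \<beta> (g \<beta>) = min_free_energy \<beta>"
  shows "((\<lambda>\<beta>. cost_gain (g \<beta>)) \<longlongrightarrow> m) at_top"
proof (rule tendstoI)
  fix e :: real assume e: "e > 0"
  obtain f where f: "f \<in> finite_entropy_densities" "m - e / 2 \<le> cost_gain f"
    using finite_entropy_near_max[of "e / 2"] e by auto
  have D: "0 \<le> divergence f" using divergence_nonneg f finite_entropyD(1) by blast
  show "\<forall>\<^sub>F \<beta> in at_top. dist (cost_gain (g \<beta>)) m < e"
    using eventually_gt_at_top[of "max 0 (2 * divergence f / e)"]
  proof eventually_elim
    case (elim \<beta>)
    then have \<beta>: "0 < \<beta>" "divergence f < \<beta> * (e / 2)" using e by (auto simp: field_simps)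
    note cg = finite_entropyD(1)[OF g(1)[OF \<beta>(1)]]
    have "\<beta> * (m - cost_gain (g \<beta>)) \<le> free_energy \<beta> (g \<beta>)"
      using divergence_nonneg[OF cg] by (simp add: free_energy_def)
    also have "\<dots> \<le> free_energy \<beta> f" unfolding g(2)[OF \<beta>(1)] using \<beta> f by (intro min_free_energy_le) auto
    also have "\<dots> \<le> \<beta> * (e / 2) + divergence f"
      unfolding free_energy_def using \<beta> f by (intro add_right_mono mult_left_mono) auto
    also have "\<dots> < \<beta> * e" using \<beta>(2) by simp
    finally have "m - cost_gain (g \<beta>) < e" using \<beta>(1) by simp
    then show ?case using cost_gain_le_max[OF cg] by (simp add: dist_real_def)
  qed
qed

lemma plan_entropy_maximiser_le:
  assumes "0 < \<beta>" and \<pi>: "\<pi> \<in> maximizing_plans \<mu> \<nu> A"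
  shows "plan_entropy \<mu> \<nu> \<pi> \<le> ereal (- min_free_energy \<beta>)"
proof (cases "plan_entropy \<mu> \<nu> \<pi> = -\<infinity>")
  case False
  have \<pi>': "\<pi> \<in> couplings \<mu> \<nu>" "(\<integral>z. A z \<partial>\<pi>) = m" using \<pi> by (auto simp: maximizing_plans_def)
  obtain f where f: "f \<in> finite_entropy_densities" "\<pi> = plan f"
    using plan_entropy_finite_cases[OF \<pi>'(1) False] by blast
  have "cost_gain f = m" using \<pi>'(2) f cost_gain_eq finite_entropyD(1) by metis
  then have "min_free_energy \<beta> \<le> divergence f"
    using min_free_energy_le[of \<beta> f] assms f by (simp add: free_energy_def)
  then show ?thesis using f by (simp add: plan_entropy_plan)
qed simp

lemma H_max_le: "0 < \<beta> \<Longrightarrow> H_max \<mu> \<nu> A \<le> ereal (- min_free_energy \<beta>)"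
  unfolding H_max_def by (intro SUP_least plan_entropy_maximiser_le)

lemma min_free_energy_unbounded:
  assumes unb: "\<And>b. \<exists>\<beta>>0. b < min_free_energy \<beta>"
  shows "((\<lambda>\<beta>. ereal (- min_free_energy \<beta>)) \<longlongrightarrow> -\<infinity>) at_top" and "H_max \<mu> \<nu> A = -\<infinity>"
proof -
  have "\<forall>\<^sub>F \<beta> in at_top. ereal (- min_free_energy \<beta>) < ereal r" for r
  proof -
    obtain b where b: "b > 0" "- r < min_free_energy b" using unb by blast
    show ?thesis
      using eventually_ge_at_top[of b]
    proof eventually_elim
      case (elim \<beta>)
      then have "- min_free_energy \<beta> < r" using b min_free_energy_mono[of b \<beta>] by linarith
      then show ?case by simp
    qed
  qed
  then show "((\<lambda>\<beta>. ereal (- min_free_energy \<beta>)) \<longlongrightarrow> -\<infinity>) at_top"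
    by (simp add: tendsto_MInfty)
  show "H_max \<mu> \<nu> A = -\<infinity>"
  proof (rule ereal_bot)
    fix B
    obtain b where b: "b > 0" "- B < min_free_energy b" using unb by blast
    then have "ereal (- min_free_energy b) \<le> ereal B" by simp
    then show "H_max \<mu> \<nu> A \<le> ereal B" using H_max_le[OF b(1)] by (rule order_trans[rotated])
  qed
qed

text \<open>In the bounded case the zero-temperature minimiser attains \<open>H_max\<close>: its divergence is at most
  \<open>l\<close> by construction, and at least \<open>l\<close> because its free energy, which equals its divergence for
  all \<open>\<beta>\<close>, is never below the minimum.\<close>

lemma min_free_energy_bounded:
  assumes bdd: "\<And>\<beta>. 0 < \<beta> \<Longrightarrow> min_free_energy \<beta> \<le> b"
  obtains g l where "(min_free_energy \<longlongrightarrow> l) at_top" "H_max \<mu> \<nu> A = ereal (- l)"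
    "g \<in> finite_entropy_densities" "cost_gain g = m" "divergence g = l"
proof -
  define l where "l = (SUP \<beta>\<in>{0<..}. min_free_energy \<beta>)"
  have bdd': "bdd_above (min_free_energy ` {0<..})" using bdd by (intro bdd_aboveI2) auto
  have le_l: "min_free_energy \<beta> \<le> l" if "0 < \<beta>" for \<beta>
    unfolding l_def using that by (intro cSUP_upper bdd') auto
  obtain g where g: "g \<in> finite_entropy_densities" "cost_gain g = m" "divergence g \<le> l"
    using zero_temperature_minimiser[OF bdd] unfolding l_def by blast
  have lim: "(min_free_energy \<longlongrightarrow> l) at_top"
  proof (rule order_tendstoI)
    fix a assume "a < l"
    then obtain b where b: "b > 0" "a < min_free_energy b"
      using less_cSUP_iff[OF _ bdd'] unfolding l_def by auto
    show "\<forall>\<^sub>F \<beta> in at_top. a < min_free_energy \<beta>"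
      using eventually_ge_at_top[of b]
    proof eventually_elim
      case (elim \<beta>)
      then show ?case using b min_free_energy_mono[of b \<beta>] by linarith
    qed
  next
    fix a assume a: "l < a"
    show "\<forall>\<^sub>F \<beta> in at_top. min_free_energy \<beta> < a"
      using eventually_gt_at_top[of 0]
    proof eventually_elim
      case (elim \<beta>)
      then show ?case using le_l a by (meson le_less_trans)
    qed
  qed
  have "min_free_energy \<beta> \<le> divergence g" if "0 < \<beta>" for \<beta>
    using min_free_energy_le[of \<beta> g] that g by (simp add: free_energy_def)
  then have "l \<le> divergence g" unfolding l_def by (intro cSUP_least) auto
  then have dg: "divergence g = l" using g by simp
  have cd: "coupling_density g" using g finite_entropyD by blast
  have "plan g \<in> maximizing_plans \<mu> \<nu> A"
    using plan_mem_couplings[OF cd] g by (simp add: maximizing_plans_def cost_gain_eq[OF cd])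
  then have "ereal (- l) \<le> H_max \<mu> \<nu> A"
    unfolding H_max_def using plan_entropy_plan[OF g(1)] dg by (metis SUP_upper)
  moreover have "((\<lambda>\<beta>. ereal (- min_free_energy \<beta>)) \<longlongrightarrow> ereal (- l)) at_top"
    using lim by (intro tendsto_intros)
  then have "H_max \<mu> \<nu> A \<le> ereal (- l)"
    by (rule tendsto_lowerbound) (use H_max_le in \<open>auto intro: eventually_mono[OF eventually_gt_at_top[of 0]]\<close>)
  ultimately show ?thesis using that[OF lim _ g(1,2) dg] by simp
qed

lemma minus_min_free_energy_tendsto_H_max: "((\<lambda>\<beta>. ereal (- min_free_energy \<beta>)) \<longlongrightarrow> H_max \<mu> \<nu> A) at_top"
proof (cases "\<exists>b. \<forall>\<beta>>0. min_free_energy \<beta> \<le> b")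
  case True
  then obtain b where "\<And>\<beta>. 0 < \<beta> \<Longrightarrow> min_free_energy \<beta> \<le> b" by blast
  then obtain l where "(min_free_energy \<longlongrightarrow> l) at_top" "H_max \<mu> \<nu> A = ereal (- l)"
    using min_free_energy_bounded by metis
  then show ?thesis by (auto intro!: tendsto_intros)
next
  case False
  then have "\<exists>\<beta>>0. b < min_free_energy \<beta>" for b by (meson not_le)
  then show ?thesis using min_free_energy_unbounded by metis
qed

end

section \<open>Accumulation points of the Gibbs plans\<close>

lemma accumulation_point_borel_probs:
  "accumulation_point weak_star_topology p F l \<Longrightarrow> l \<in> borel_probs"
  unfolding accumulation_point_def weak_star_topology_def topology_generated_by_topspace by auto

lemma accumulation_point_integral:
  fixes u :: "'a::topological_space \<Rightarrow> real"
  assumes acc: "accumulation_point weak_star_topology p F l"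
    and u: "continuous_on UNIV u" and lim: "((\<lambda>b. \<integral>z. u z \<partial>p b) \<longlongrightarrow> c) F"
  shows "(\<integral>z. u z \<partial>l) = c"
proof (rule ccontr)
  assume ne: "(\<integral>z. u z \<partial>l) \<noteq> c"
  obtain U V where UV: "open U" "open V" "(\<integral>z. u z \<partial>l) \<in> U" "c \<in> V" "U \<inter> V = {}"
    using hausdorff[OF ne] by auto
  let ?W = "{\<eta> \<in> borel_probs. (\<integral>z. u z \<partial>\<eta>) \<in> U}"
  have "openin weak_star_topology ?W"
    unfolding weak_star_topology_def by (rule topology_generated_by_Basis) (use u UV in blast)
  moreover have "l \<in> ?W" using UV accumulation_point_borel_probs[OF acc] by simp
  ultimately have "\<exists>\<^sub>F b in F. p b \<in> ?W" using acc unfolding accumulation_point_def by blast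
  moreover have "\<forall>\<^sub>F b in F. (\<integral>z. u z \<partial>p b) \<in> V" using topological_tendstoD[OF lim UV(2,4)] .
  ultimately have "\<exists>\<^sub>F b in F. p b \<in> ?W \<and> (\<integral>z. u z \<partial>p b) \<in> V"
    by (rule frequently_eventually_frequently)
  then show False using UV(5) by (auto dest: frequently_ex)
qed

context transport_problem
begin

text \<open>The weak* topology is tested on continuous functions only; applied to functions of one
  variable this pins down the marginals, and applied to \<open>A\<close> it gives optimality. When \<open>H_max\<close> is
  finite, the Gibbs densities converge in \<open>L\<^sup>1\<close>, because the zero-temperature minimiser is almost
  minimal at every large \<open>\<beta>\<close>; so the accumulation point is that minimiser. When \<open>H_max = -\<infinity>\<close>,
  every maximising plan has entropy \<open>-\<infinity>\<close>.\<close>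

lemma accumulation_point_of_minimisers:
  assumes g: "\<And>\<beta>. 0 < \<beta> \<Longrightarrow> g \<beta> \<in> finite_entropy_densities"
    "\<And>\<beta>. 0 < \<beta> \<Longrightarrow> free_energy \<beta> (g \<beta>) = min_free_energy \<beta>"
    and p: "\<And>\<beta>. 0 < \<beta> \<Longrightarrow> p \<beta> = plan (g \<beta>)"
    and acc: "accumulation_point weak_star_topology p at_top \<pi>"
  shows "\<pi> \<in> maximizing_plans \<mu> \<nu> A" and "plan_entropy \<mu> \<nu> \<pi> = H_max \<mu> \<nu> A"
proof -
  note bp = accumulation_point_borel_probs[OF acc]
  note pos = eventually_gt_at_top[of "0 :: real"]
  have cd: "coupling_density (g \<beta>)" if "0 < \<beta>" for \<beta> using g(1)[OF that] finite_entropyD by blast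
  have integral_eq: "(\<integral>z. u z \<partial>\<pi>) = c"
    if "continuous_on UNIV u" "((\<lambda>\<beta>. \<integral>z. u z \<partial>plan (g \<beta>)) \<longlongrightarrow> c) at_top" for u :: "'x \<times> 'y \<Rightarrow> real" and c
  proof (rule accumulation_point_integral[OF acc that(1)])
    show "((\<lambda>\<beta>. \<integral>z. u z \<partial>p \<beta>) \<longlongrightarrow> c) at_top"
      by (rule Lim_transform_eventually[OF that(2)]) (use pos in \<open>eventually_elim, simp add: p\<close>)
  qed
  have [measurable_cong]: "sets \<pi> = sets borel" using bp by (simp add: borel_probs_def)
  interpret \<pi>: prob_space \<pi> using bp by (simp add: borel_probs_def)
  have "distr \<pi> borel fst = \<mu>"
  proof (rule borel_probs_eqI_continuous[OF _ borel_prob_\<mu>])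
    show "distr \<pi> borel fst \<in> borel_probs" by (auto simp: borel_probs_def intro: \<pi>.prob_space_distr)
    fix u :: "'x \<Rightarrow> real" assume u: "continuous_on UNIV u"
    have "(\<integral>x. u x \<partial>distr \<pi> borel fst) = (\<integral>z. u (fst z) \<partial>\<pi>)"
      by (rule integral_distr) (use u in \<open>auto intro: borel_measurable_continuous_onI\<close>)
    also have "\<dots> = (\<integral>x. u x \<partial>\<mu>)"
    proof (rule integral_eq)
      show "continuous_on UNIV (\<lambda>z :: 'x \<times> 'y. u (fst z))"
        using u by (rule continuous_fst_function)
      show "((\<lambda>\<beta>. \<integral>z. u (fst z) \<partial>plan (g \<beta>)) \<longlongrightarrow> (\<integral>x. u x \<partial>\<mu>)) at_top"
        by (rule tendsto_eventually)
          (use pos in \<open>eventually_elim, simp add: integral_couplings_marginal(1)[OF plan_mem_couplings[OF cd] u]\<close>)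
    qed
    finally show "(\<integral>x. u x \<partial>distr \<pi> borel fst) = (\<integral>x. u x \<partial>\<mu>)" .
  qed
  moreover have "distr \<pi> borel snd = \<nu>"
  proof (rule borel_probs_eqI_continuous[OF _ borel_prob_\<nu>])
    show "distr \<pi> borel snd \<in> borel_probs" by (auto simp: borel_probs_def intro: \<pi>.prob_space_distr)
    fix u :: "'y \<Rightarrow> real" assume u: "continuous_on UNIV u"
    have "(\<integral>x. u x \<partial>distr \<pi> borel snd) = (\<integral>z. u (snd z) \<partial>\<pi>)"
      by (rule integral_distr) (use u in \<open>auto intro: borel_measurable_continuous_onI\<close>)
    also have "\<dots> = (\<integral>x. u x \<partial>\<nu>)"
    proof (rule integral_eq)
      show "continuous_on UNIV (\<lambda>z :: 'x \<times> 'y. u (snd z))"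
        using u by (rule continuous_snd_function)
      show "((\<lambda>\<beta>. \<integral>z. u (snd z) \<partial>plan (g \<beta>)) \<longlongrightarrow> (\<integral>x. u x \<partial>\<nu>)) at_top"
        by (rule tendsto_eventually)
          (use pos in \<open>eventually_elim, simp add: integral_couplings_marginal(2)[OF plan_mem_couplings[OF cd] u]\<close>)
    qed
    finally show "(\<integral>x. u x \<partial>distr \<pi> borel snd) = (\<integral>x. u x \<partial>\<nu>)" .
  qed
  moreover have "(\<integral>z. A z \<partial>\<pi>) = m"
  proof (rule integral_eq[OF continuous_A])
    show "((\<lambda>\<beta>. \<integral>z. A z \<partial>plan (g \<beta>)) \<longlongrightarrow> m) at_top"
      by (rule Lim_transform_eventually[OF minimisers_gain_tendsto_max[of g]], use g in \<open>simp_all\<close>)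
        (use pos in \<open>eventually_elim, simp add: cost_gain_eq cd\<close>)
  qed
  ultimately show max: "\<pi> \<in> maximizing_plans \<mu> \<nu> A"
    using bp by (simp add: maximizing_plans_def couplings_def)
  then have le: "plan_entropy \<mu> \<nu> \<pi> \<le> H_max \<mu> \<nu> A" unfolding H_max_def by (rule SUP_upper)
  show "plan_entropy \<mu> \<nu> \<pi> = H_max \<mu> \<nu> A"
  proof (cases "\<exists>b. \<forall>\<beta>>0. min_free_energy \<beta> \<le> b")
    case False
    then have "\<exists>\<beta>>0. b < min_free_energy \<beta>" for b by (meson not_le)
    then have "H_max \<mu> \<nu> A = -\<infinity>" by (rule min_free_energy_unbounded)
    then show ?thesis using le by simp
  next
    case True
    then obtain b where "\<And>\<beta>. 0 < \<beta> \<Longrightarrow> min_free_energy \<beta> \<le> b" by blast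
    then obtain f l where lim: "(min_free_energy \<longlongrightarrow> l) at_top" and H: "H_max \<mu> \<nu> A = ereal (- l)"
      and f: "f \<in> finite_entropy_densities" "cost_gain f = m" "divergence f = l"
      using min_free_energy_bounded by metis
    have fcd: "coupling_density f" using f finite_entropyD by blast
    have L1: "((\<lambda>\<beta>. \<integral>z. \<bar>g \<beta> z - f z\<bar> \<partial>\<rho>) \<longlongrightarrow> 0) at_top"
    proof (rule tendstoI)
      fix e :: real assume e: "e > 0"
      \<comment> \<open>With this weight the term \<open>4 * s\<close> of the strong convexity estimate is \<open>e / 2\<close>.\<close>
      define s where "s = e / 8"
      have s: "s > 0" using e by (simp add: s_def)
      have "\<forall>\<^sub>F \<beta> in at_top. l - s * e / 2 < min_free_energy \<beta>"
        using s e by (intro order_tendstoD(1)[OF lim]) simp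
      then show "\<forall>\<^sub>F \<beta> in at_top. dist (\<integral>z. \<bar>g \<beta> z - f z\<bar> \<partial>\<rho>) 0 < e"
        using pos
      proof eventually_elim
        case (elim \<beta>)
        have "(\<integral>z. \<bar>g \<beta> z - f z\<bar> \<partial>\<rho>) \<le>
            (free_energy \<beta> (g \<beta>) + free_energy \<beta> f - 2 * min_free_energy \<beta>) / s + 4 * s"
          using elim s by (intro L1_dist_le_free_energy_excess g(1) f(1)) auto
        also have "free_energy \<beta> (g \<beta>) + free_energy \<beta> f - 2 * min_free_energy \<beta> = l - min_free_energy \<beta>"
          using elim g(2) f by (simp add: free_energy_def)
        also have "(l - min_free_energy \<beta>) / s < e / 2"
          using elim s by (simp add: field_simps)
        finally have "(\<integral>z. \<bar>g \<beta> z - f z\<bar> \<partial>\<rho>) < e" by (simp add: s_def)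
        moreover have "0 \<le> (\<integral>z. \<bar>g \<beta> z - f z\<bar> \<partial>\<rho>)" by simp
        ultimately show ?case by (simp add: dist_real_def)
      qed
    qed
    have "\<pi> = plan f"
    proof (rule borel_probs_eqI_continuous[OF bp])
      show "plan f \<in> borel_probs" using plan_mem_couplings[OF fcd] by (simp add: couplings_def)
      fix u :: "'x \<times> 'y \<Rightarrow> real"
      assume u: "continuous_on UNIV u" and u01: "\<And>z. 0 \<le> u z \<and> u z \<le> 1"
      have [measurable]: "u \<in> borel_measurable borel" using u by (rule borel_measurable_continuous_onI)
      show "(\<integral>z. u z \<partial>\<pi>) = (\<integral>z. u z \<partial>plan f)"
      proof (rule integral_eq[OF u], rule LIM_zero_cancel, rule Lim_null_comparison[OF _ L1])
        show "\<forall>\<^sub>F \<beta> in at_top. norm ((\<integral>z. u z \<partial>plan (g \<beta>)) - (\<integral>z. u z \<partial>plan f)) \<le> (\<integral>z. \<bar>g \<beta> z - f z\<bar> \<partial>\<rho>)"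
          using pos
        proof eventually_elim
          case (elim \<beta>)
          note gi = coupling_density_integrable[OF cd[OF elim]] and fi = coupling_density_integrable[OF fcd]
          have int: "integrable \<rho> (\<lambda>z. u z * g \<beta> z)" "integrable \<rho> (\<lambda>z. u z * f z)"
            using u01 by (auto intro!: integrable_bounded_mult[where C=1] gi fi simp: abs_le_iff)
          have "(\<integral>z. u z \<partial>plan (g \<beta>)) - (\<integral>z. u z \<partial>plan f) = (\<integral>z. u z * g \<beta> z - u z * f z \<partial>\<rho>)"
            using int by (simp add: integral_plan cd elim fcd)
          also have "norm \<dots> \<le> (\<integral>z. \<bar>u z * g \<beta> z - u z * f z\<bar> \<partial>\<rho>)"
            using integral_norm_bound[of \<rho> "\<lambda>z. u z * g \<beta> z - u z * f z"] by simp
          also have "\<dots> \<le> (\<integral>z. \<bar>g \<beta> z - f z\<bar> \<partial>\<rho>)"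
          proof (rule integral_mono)
            show "\<bar>u z * g \<beta> z - u z * f z\<bar> \<le> \<bar>g \<beta> z - f z\<bar>" for z
              using u01[of z] by (auto simp: abs_mult mult_left_le_one_le simp flip: right_diff_distrib)
          qed (use int gi fi in auto)
          finally show ?case .
        qed
      qed
    qed
    then show ?thesis using f H by (simp add: plan_entropy_plan)
  qed
qed

end

lemma lipschitz_sum_dist_continuous:
  assumes "lipschitz_sum_dist c"
  shows "continuous_on UNIV c"
proof -
  obtain L where L: "\<And>p q. \<bar>c p - c q\<bar> \<le> L * sum_dist p q"
    using assms by (auto simp: lipschitz_sum_dist_def)
  have "(c \<longlongrightarrow> c p) (at p)" for p
  proof (rule LIM_zero_cancel, rule Lim_null_comparison)
    show "\<forall>\<^sub>F q in at p. norm (c q - c p) \<le> L * sum_dist q p" using L by simp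
    have "((\<lambda>q. L * sum_dist q p) \<longlongrightarrow> L * sum_dist p p) (at p)"
      unfolding sum_dist_def by (intro tendsto_intros)
    then show "((\<lambda>q. L * sum_dist q p) \<longlongrightarrow> 0) (at p)" by (simp add: sum_dist_def)
  qed
  then show ?thesis by (simp add: continuous_on_def)
qed

theorem proposition1p4:
  fixes \<mu> :: "'x::metric_space measure"
    and \<nu> :: "'y::metric_space measure"
    and c A :: "'x \<times> 'y \<Rightarrow> real"
  assumes "compact (UNIV :: 'x set)" and "compact (UNIV :: 'y set)"
    and "\<mu> \<in> borel_probs" and "\<nu> \<in> borel_probs"
    and "measure_support \<mu> = UNIV" and "measure_support \<nu> = UNIV"
    and "lipschitz_sum_dist c"
    and "A = (\<lambda>p. - c p)"
  shows
    "antimono_on {0<..}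
       (\<lambda>\<beta>::real. pressure \<mu> \<nu> (\<lambda>p. \<beta> * A p) - ereal (\<beta> * max_integral \<mu> \<nu> A))
     \<and> ((\<lambda>\<beta>::real. pressure \<mu> \<nu> (\<lambda>p. \<beta> * A p) - ereal (\<beta> * max_integral \<mu> \<nu> A))
         \<longlongrightarrow> H_max \<mu> \<nu> A) at_top
     \<and> (\<forall>\<phi> \<psi> \<pi>_inf.
          (\<forall>\<beta>>0. normalizing_pair \<mu> \<nu> (\<lambda>p. \<beta> * A p) (\<phi> \<beta>) (\<psi> \<beta>)) \<longrightarrow>
          accumulation_point weak_star_topology
            (\<lambda>\<beta>::real. gibbs_plan \<mu> \<nu> (\<lambda>p. \<beta> * A p) (\<phi> \<beta>) (\<psi> \<beta>)) at_top \<pi>_inf \<longrightarrow>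
          \<pi>_inf \<in> maximizing_plans \<mu> \<nu> A \<and> plan_entropy \<mu> \<nu> \<pi>_inf = H_max \<mu> \<nu> A)"
proof -
  have "continuous_on UNIV A"
    unfolding assms(8) using lipschitz_sum_dist_continuous[OF assms(7)] by (intro continuous_intros)
  then interpret transport_problem \<mu> \<nu> A
    using assms by unfold_locales
  let ?F = "\<lambda>\<beta>::real. pressure \<mu> \<nu> (\<lambda>p. \<beta> * A p) - ereal (\<beta> * max_integral \<mu> \<nu> A)"
  have F: "?F \<beta> = ereal (- min_free_energy \<beta>)" if "0 < \<beta>" for \<beta>
    using pressure_eq_min_free_energy that by simp
  have "antimono_on {0<..} ?F"
    by (rule monotone_onI) (auto simp: F intro: min_free_energy_mono)
  moreover have "(?F \<longlongrightarrow> H_max \<mu> \<nu> A) at_top"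
    by (rule Lim_transform_eventually[OF minus_min_free_energy_tendsto_H_max])
      (use eventually_gt_at_top[of 0] in \<open>eventually_elim, simp add: F\<close>)
  moreover have "\<pi> \<in> maximizing_plans \<mu> \<nu> A \<and> plan_entropy \<mu> \<nu> \<pi> = H_max \<mu> \<nu> A"
    if np: "\<forall>\<beta>>0. normalizing_pair \<mu> \<nu> (\<lambda>p. \<beta> * A p) (\<phi> \<beta>) (\<psi> \<beta>)"
      and acc: "accumulation_point weak_star_topology
        (\<lambda>\<beta>::real. gibbs_plan \<mu> \<nu> (\<lambda>p. \<beta> * A p) (\<phi> \<beta>) (\<psi> \<beta>)) at_top \<pi>" for \<phi> \<psi> \<pi>
  proof -
    have "\<exists>g. gibbs_plan \<mu> \<nu> (\<lambda>p. \<beta> * A p) (\<phi> \<beta>) (\<psi> \<beta>) = plan g \<and> g \<in> finite_entropy_densities \<and>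
        free_energy \<beta> g = min_free_energy \<beta>" if "0 < \<beta>" for \<beta>
      using gibbs_plan_minimises[of \<beta> "\<phi> \<beta>" "\<psi> \<beta>"] np that by (metis less_imp_le)
    then obtain g where g: "\<And>\<beta>. 0 < \<beta> \<Longrightarrow> gibbs_plan \<mu> \<nu> (\<lambda>p. \<beta> * A p) (\<phi> \<beta>) (\<psi> \<beta>) = plan (g \<beta>) \<and>
        g \<beta> \<in> finite_entropy_densities \<and> free_energy \<beta> (g \<beta>) = min_free_energy \<beta>"
      by metis
    show ?thesis using accumulation_point_of_minimisers[of g, OF _ _ _ acc] g by simp
  qed
  ultimately show ?thesis by blast
qed

end
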